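(* In Situation 1 there exists at least one Stackelberg equilibrium with firm $I$ as the leader. Moreover, any such Stackelberg equilibrium $(\hat e,\hat m,\hat a,\hat\alpha,\hat\beta,\hat\gamma)$ with $\hat\alpha>0$ satisfies $$\hat e=(\varphi')^{-1}\Big(\frac1{(1-\hat\beta)^+}\Big),\quad \hat a=(\psi')^{-1}\Big(\frac{1+r_J}{(\delta(1-\hat\beta))^+}\Big),\quad \hat m=[(b^m)']^{-1}(1),\quad\hat\gamma=\frac1{g'(\hat m)},$$ $$\hat\alpha=C(\hat\beta)+(1+r_J)(D+\hat a)+\hat e-(1-\hat\beta)\delta\psi(\hat a)-G(\hat m),$$ and: - if $\delta>0$, then $\hat\beta<\frac v{u+v}$ and $\hat\beta$ is a solution of $h(u\beta)-h(v(1-\beta))=S(\beta)+\widetilde S(\beta)$; - if $\delta<0$, then either $\hat\beta<\frac v{u+v}$ and $\hat\beta$ solves $h(u\beta)-h(v(1-\beta))=S(\beta)$, or $\hat\beta>1$ and $\hat\beta$ solves $h(u\beta)-h(v(1-\beta))=\widetilde S(\beta)$. The corresponding optimal values for firms $J$ and $I$ are respectively $V(0)$ and $I^1(\hat\alpha,\hat\beta,\hat\gamma)$ (the payoff of firm $I$ evaluated at the equilibrium).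
   Context: Standing assumptions. $u,v>0$, $U(x)=-e^{-ux}$, $V(x)=-e^{-vx}$; $D>0$, $r_J\ge 0$, $\delta\in\mathbb R$, $x^+=\max(x,0)$. $\mu$ is a non-constant real random variable bounded from below by a finite constant $\underline\mu$, with $\mathbb E[e^{\lambda\mu}]<\infty$ for all $\lambda\in\mathbb R$. $\varphi,\psi:\mathbb R_+\to\mathbb R_+$ are $C^1$, increasing, strictly concave, $\varphi'(0)=\psi'(0)=+\infty$, $\varphi'(\infty)=\psi'(\infty)=0$, $\varphi(\infty)+\delta^+\psi(\infty)<\underline\mu$, and $(\varphi')^{-1}(x)\sim(\psi')^{-1}(x)$ as $x\to0$; where $\varphi'',\psi''$ appear, $\varphi,\psi$ are $C^2$ on $(0,\infty)$ with $\varphi''<0$, $\psi''<0$. $g:\mathbb R_+\to\mathbb R$ is $C^1$, increasing, strictly concave, $g'(0)=\infty$, $g'(\infty)=0$, and $\inf\{m>0:g(m)>0\}<\infty$. $b^a,b^m,b^e:\mathbb R_+\to\mathbb R_+$ are $C^1$, increasing, concave; $(b^a)'(0)>0$ (possibly infinite), $(b^a)'(\infty)=0$, $b^a(\infty)<\infty$; $(b^m)'(0)=(b^e)'(0)=\infty$, $(b^m)'(\infty)=(b^e)'(\infty)=0$. (A function with infinite derivative at $0$ is continuous on $\mathbb R_+$ and differentiable on $(0,\infty)$.) Conventions: $(\phi')^{-1}(+\infty)=0$ for $\phi=\varphi,\psi,g$; $x/0=+\infty$ for $x>0$. Situation 1. Write $C^{op}=\mu-\varphi(e)-\delta\psi(a)$.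 Firm $J$ controls $(a,e,m)\in\mathbb R_+^3$ and firm $I$ controls $(\alpha,\beta,\gamma)\in\mathbb R_+\times\mathbb R\times\mathbb R_+$. The payoffs are $$J^1=\mathbb E\big[V\big(\alpha+(\beta-1)C^{op}-e+\gamma g(m)-m-(1+r_J)(D+a)\big)\big],$$ $$I^1=\mathbb E\big[b^a(a)+U\big(b^m(m)+b^e(e)-\alpha-\beta C^{op}-\gamma g(m)\big)\big].$$ Given $(\alpha,\beta,\gamma)$, firm $J$'s unique best response (maximizer of $J^1$) is $$e^*(\beta)=(\varphi')^{-1}\Big(\frac1{(1-\beta)^+}\Big),\quad a^*(\beta)=(\psi')^{-1}\Big(\frac{1+r_J}{(\delta(1-\beta))^+}\Big),\quad m^*(\gamma)=(g')^{-1}(1/\gamma).$$ A Stackelberg equilibrium with firm $I$ as leader is a vector $(\hat e,\hat m,\hat a,\hat\alpha,\hat\beta,\hat\gamma)$ where $(\hat\alpha,\hat\beta,\hat\gamma)$ maximizes $I^1$ evaluated at $(a,e,m)=(a^*(\beta),e^*(\beta),m^*(\gamma))$ over all $(\alpha,\beta,\gamma)\in\mathbb R_+\times\mathbb R\times\mathbb R_+$ for which $J^1$ evaluated at the same $(a,e,m)$ is $\ge V(0)$, and $\hat e=e^*(\hat\beta)$, $\hat a=a^*(\hat\beta)$, $\hat m=m^*(\hat\gamma)$. Notation ($\mathrm{Id}$ is the identity map). $h(\lambda)=\frac{\mathbb E[\mu e^{\lambda\mu}]}{\mathbb E[e^{\lambda\mu}]}$; $G(m)=\frac{g(m)}{g'(m)}-m$;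 $C(\beta)=\frac1v\ln\mathbb E\big[e^{v(1-\beta)(\mu-\varphi(e^*(\beta)))}\big]$; $$S(\beta)=\frac{\frac\beta{1-\beta}+(b^e)'(e^*(\beta))}{(1-\beta)^2\varphi''(e^*(\beta))}\quad(\beta<1);$$ $$\widetilde S(\beta)=\frac{1+r_J}{\delta(1-\beta)^2\psi''(a^*(\beta))}\left((1+r_J)\frac\beta{1-\beta}+\frac{(b^a)'(a^*(\beta))}{u\,e^{u(\mathrm{Id}-b^m)([(b^m)']^{-1}(1))}\,k(\beta)}\right)\quad(\delta(1-\beta)>0),$$ $$k(\beta)=e^{u(\mathrm{Id}-b^e)(e^*(\beta))}\,e^{-u\delta\psi(a^*(\beta))}\,e^{u(1+r_J)(D+a^*(\beta))}\,e^{uC(\beta)}\,\mathbb E\big[e^{u\beta(\mu-\varphi(e^*(\beta)))}\big].$$ *)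

theory Defs
  imports "HOL-Probability.Probability" "HOL-Library.Landau_Symbols"
begin

definition strictly_concave_on :: "real set \<Rightarrow> (real \<Rightarrow> real) \<Rightarrow> bool" where
  "strictly_concave_on S f \<longleftrightarrow> convex S \<and>
     (\<forall>x\<in>S. \<forall>y\<in>S. \<forall>t. x \<noteq> y \<and> 0 < t \<and> t < 1 \<longrightarrow>
        (1 - t) * f x + t * f y < f ((1 - t) * x + t * y))"

(* Functions on the half-line are total functions of which only the values on [0, \<infinity>) matter.
   The derivative at 0, which may be infinite, is always expressed as the right limit at 0 of the
   derivative; the library value deriv f 0 is never used. *)
definition C1_halfline :: "(real \<Rightarrow> real) \<Rightarrow> bool" where
  "C1_halfline f \<longleftrightarrow> continuous_on {0..} f \<and>
     (\<forall>x>0. f differentiable (at x)) \<and> continuous_on {0<..} (deriv f)"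

(* Points where f' takes the value y, with f'(0) = \<infinity>. This is at most one point if f is strictly
   concave, but possibly an interval if f is merely concave. *)
definition deriv_level :: "(real \<Rightarrow> real) \<Rightarrow> ereal \<Rightarrow> real set" where
  "deriv_level f y = (if y = \<infinity> then {0} else {x. 0 < x \<and> ereal (deriv f x) = y})"

(* The inverse of f'. Arguments are extended reals, where the library already has
   x / 0 = \<infinity> for x > 0. *)
definition deriv_inv :: "(real \<Rightarrow> real) \<Rightarrow> ereal \<Rightarrow> real" where
  "deriv_inv f y = (SOME x. x \<in> deriv_level f y)"

locale situation1 = prob_space M
  for M :: "'w measure" and \<mu> :: "'w \<Rightarrow> real" and \<mu>\<^sub>0 u v D r \<delta> :: real
    and \<phi> \<psi> g ba bm be :: "real \<Rightarrow> real" +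
  assumes u_pos: "u > 0" and v_pos: "v > 0" and D_pos: "D > 0" and r_nonneg: "r \<ge> 0"
    and mu_rv: "random_variable borel \<mu>"
    and mu_nonconst: "\<not> (\<exists>c. AE \<omega> in M. \<mu> \<omega> = c)"
    and mu_bounded_below: "AE \<omega> in M. \<mu>\<^sub>0 \<le> \<mu> \<omega>"
    and mu_exp_moments: "\<And>t. integrable M (\<lambda>\<omega>. exp (t * \<mu> \<omega>))"

    and phi_C1: "C1_halfline \<phi>"
    and phi_nonneg: "\<And>x. x \<ge> 0 \<Longrightarrow> \<phi> x \<ge> 0"
    and phi_mono: "mono_on {0..} \<phi>"
    and phi_concave: "strictly_concave_on {0..} \<phi>"
    and phi_deriv_0: "filterlim (deriv \<phi>) at_top (at_right 0)"
    and phi_deriv_infinity: "(deriv \<phi> \<longlongrightarrow> 0) at_top"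
    and phi_twice_diff: "\<And>x. x > 0 \<Longrightarrow> deriv \<phi> differentiable (at x)"
    and phi_deriv2_cont: "continuous_on {0<..} (deriv (deriv \<phi>))"
    and phi_deriv2_neg: "\<And>x. x > 0 \<Longrightarrow> deriv (deriv \<phi>) x < 0"

    and psi_C1: "C1_halfline \<psi>"
    and psi_nonneg: "\<And>x. x \<ge> 0 \<Longrightarrow> \<psi> x \<ge> 0"
    and psi_mono: "mono_on {0..} \<psi>"
    and psi_concave: "strictly_concave_on {0..} \<psi>"
    and psi_deriv_0: "filterlim (deriv \<psi>) at_top (at_right 0)"
    and psi_deriv_infinity: "(deriv \<psi> \<longlongrightarrow> 0) at_top"
    and psi_twice_diff: "\<And>x. x > 0 \<Longrightarrow> deriv \<psi> differentiable (at x)"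
    and psi_deriv2_cont: "continuous_on {0<..} (deriv (deriv \<psi>))"
    and psi_deriv2_neg: "\<And>x. x > 0 \<Longrightarrow> deriv (deriv \<psi>) x < 0"

    \<comment> \<open>The values at infinity are suprema by monotonicity, and 0 times infinity is 0.\<close>
    and phi_psi_bound:
      "(SUP x\<in>{0..}. ereal (\<phi> x)) + ereal (max \<delta> 0) * (SUP x\<in>{0..}. ereal (\<psi> x)) < ereal \<mu>\<^sub>0"
    and phi_psi_equiv:
      "asymp_equiv (\<lambda>x. deriv_inv \<phi> (ereal x)) (at_right 0) (\<lambda>x. deriv_inv \<psi> (ereal x))"

    and g_C1: "C1_halfline g"
    and g_mono: "mono_on {0..} g"
    and g_concave: "strictly_concave_on {0..} g"
    and g_deriv_0: "filterlim (deriv g) at_top (at_right 0)"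
    and g_deriv_infinity: "(deriv g \<longlongrightarrow> 0) at_top"
    and g_eventually_pos: "(INF m\<in>{m. 0 < m \<and> 0 < g m}. ereal m) < \<infinity>"

    and ba_C1: "C1_halfline ba"
    and ba_nonneg: "\<And>x. x \<ge> 0 \<Longrightarrow> ba x \<ge> 0"
    and ba_mono: "mono_on {0..} ba"
    and ba_concave: "concave_on {0..} ba"
    and ba_deriv_0: "\<exists>L::ereal. L > 0 \<and> ((\<lambda>x. ereal (deriv ba x)) \<longlongrightarrow> L) (at_right 0)"
    and ba_deriv_infinity: "(deriv ba \<longlongrightarrow> 0) at_top"
    and ba_bounded: "(SUP x\<in>{0..}. ereal (ba x)) < \<infinity>"

    and bm_C1: "C1_halfline bm"
    and bm_nonneg: "\<And>x. x \<ge> 0 \<Longrightarrow> bm x \<ge> 0"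
    and bm_mono: "mono_on {0..} bm"
    and bm_concave: "concave_on {0..} bm"
    and bm_deriv_0: "filterlim (deriv bm) at_top (at_right 0)"
    and bm_deriv_infinity: "(deriv bm \<longlongrightarrow> 0) at_top"

    and be_C1: "C1_halfline be"
    and be_nonneg: "\<And>x. x \<ge> 0 \<Longrightarrow> be x \<ge> 0"
    and be_mono: "mono_on {0..} be"
    and be_concave: "concave_on {0..} be"
    and be_deriv_0: "filterlim (deriv be) at_top (at_right 0)"
    and be_deriv_infinity: "(deriv be \<longlongrightarrow> 0) at_top"
begin

definition U :: "real \<Rightarrow> real" where "U x = - exp (- u * x)"

definition V :: "real \<Rightarrow> real" where "V x = - exp (- v * x)"

definition Cop :: "real \<Rightarrow> real \<Rightarrow> 'w \<Rightarrow> real" where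
  "Cop a e \<omega> = \<mu> \<omega> - \<phi> e - \<delta> * \<psi> a"

definition J1 :: "real \<Rightarrow> real \<Rightarrow> real \<Rightarrow> real \<Rightarrow> real \<Rightarrow> real \<Rightarrow> real" where
  "J1 \<alpha> \<beta> \<gamma> a e m =
     expectation (\<lambda>\<omega>. V (\<alpha> + (\<beta> - 1) * Cop a e \<omega> - e + \<gamma> * g m - m - (1 + r) * (D + a)))"

definition I1 :: "real \<Rightarrow> real \<Rightarrow> real \<Rightarrow> real \<Rightarrow> real \<Rightarrow> real \<Rightarrow> real" where
  "I1 \<alpha> \<beta> \<gamma> a e m =
     expectation (\<lambda>\<omega>. ba a + U (bm m + be e - \<alpha> - \<beta> * Cop a e \<omega> - \<gamma> * g m))"

definition e_star :: "real \<Rightarrow> real" where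
  "e_star \<beta> = deriv_inv \<phi> (1 / ereal (max (1 - \<beta>) 0))"

definition a_star :: "real \<Rightarrow> real" where
  "a_star \<beta> = deriv_inv \<psi> (ereal (1 + r) / ereal (max (\<delta> * (1 - \<beta>)) 0))"

definition m_star :: "real \<Rightarrow> real" where
  "m_star \<gamma> = deriv_inv g (1 / ereal \<gamma>)"

definition feasible :: "real \<Rightarrow> real \<Rightarrow> real \<Rightarrow> bool" where
  "feasible \<alpha> \<beta> \<gamma> \<longleftrightarrow> \<alpha> \<ge> 0 \<and> \<gamma> \<ge> 0 \<and>
     J1 \<alpha> \<beta> \<gamma> (a_star \<beta>) (e_star \<beta>) (m_star \<gamma>) \<ge> V 0"

definition I1_leader :: "real \<Rightarrow> real \<Rightarrow> real \<Rightarrow> real" where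
  "I1_leader \<alpha> \<beta> \<gamma> = I1 \<alpha> \<beta> \<gamma> (a_star \<beta>) (e_star \<beta>) (m_star \<gamma>)"

definition stackelberg :: "real \<Rightarrow> real \<Rightarrow> real \<Rightarrow> real \<Rightarrow> real \<Rightarrow> real \<Rightarrow> bool" where
  "stackelberg e m a \<alpha> \<beta> \<gamma> \<longleftrightarrow>
     feasible \<alpha> \<beta> \<gamma> \<and>
     (\<forall>\<alpha>' \<beta>' \<gamma>'. feasible \<alpha>' \<beta>' \<gamma>' \<longrightarrow> I1_leader \<alpha>' \<beta>' \<gamma>' \<le> I1_leader \<alpha> \<beta> \<gamma>) \<and>
     e = e_star \<beta> \<and> a = a_star \<beta> \<and> m = m_star \<gamma>"

definition value_I :: real where
  "value_I = Sup {I1_leader \<alpha> \<beta> \<gamma> | \<alpha> \<beta> \<gamma>. feasible \<alpha> \<beta> \<gamma>}"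

definition value_J :: "real \<Rightarrow> real \<Rightarrow> real \<Rightarrow> real" where
  "value_J \<alpha> \<beta> \<gamma> = Sup {J1 \<alpha> \<beta> \<gamma> a e m | a e m. a \<ge> 0 \<and> e \<ge> 0 \<and> m \<ge> 0}"

definition h :: "real \<Rightarrow> real" where
  "h t = expectation (\<lambda>\<omega>. \<mu> \<omega> * exp (t * \<mu> \<omega>)) / expectation (\<lambda>\<omega>. exp (t * \<mu> \<omega>))"

definition G :: "real \<Rightarrow> real" where
  "G m = g m / deriv g m - m"

definition C :: "real \<Rightarrow> real" where
  "C \<beta> = 1 / v * ln (expectation (\<lambda>\<omega>. exp (v * (1 - \<beta>) * (\<mu> \<omega> - \<phi> (e_star \<beta>)))))"

definition S :: "real \<Rightarrow> real" where
  "S \<beta> = (\<beta> / (1 - \<beta>) + deriv be (e_star \<beta>)) / ((1 - \<beta>)\<^sup>2 * deriv (deriv \<phi>) (e_star \<beta>))"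

definition k :: "real \<Rightarrow> real" where
  "k \<beta> = exp (u * (e_star \<beta> - be (e_star \<beta>))) * exp (- u * \<delta> * \<psi> (a_star \<beta>)) *
     exp (u * (1 + r) * (D + a_star \<beta>)) * exp (u * C \<beta>) *
     expectation (\<lambda>\<omega>. exp (u * \<beta> * (\<mu> \<omega> - \<phi> (e_star \<beta>))))"

(* The choice made by deriv_inv bm 1 is immaterial: x - bm x is constant on deriv_level bm 1. *)
definition S_tilde :: "real \<Rightarrow> real" where
  "S_tilde \<beta> = (1 + r) / (\<delta> * (1 - \<beta>)\<^sup>2 * deriv (deriv \<psi>) (a_star \<beta>)) *
     ((1 + r) * (\<beta> / (1 - \<beta>)) +
      deriv ba (a_star \<beta>) /
        (u * exp (u * (deriv_inv bm 1 - bm (deriv_inv bm 1))) * k \<beta>))"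

end

end

theory Submission
  imports Defs
begin

text \<open>Write \<open>cgf\<close> for the cumulant generating function of \<open>\<mu>\<close>; its derivative is \<open>h\<close>, which is strictly
  increasing. The participation constraint bounds \<open>\<alpha>\<close> from below by a function of \<open>(\<beta>, \<gamma>)\<close>, and the leader
  takes the least admissible \<open>\<alpha>\<close>. What remains is a continuous function of \<open>(\<beta>, \<gamma>)\<close> bounded above by
  \<open>sup ba - exp (u * (m - bm m)) * k \<beta>\<close> with \<open>m = m_star \<gamma>\<close>. Here \<open>m - bm m\<close> is coercive because \<open>bm'\<close>
  vanishes at infinity, and \<open>ln k\<close> is coercive because \<open>cgf (v * (1 - \<beta>)) / v + cgf (u * \<beta>) / u\<close> is
  strictly convex with minimum at \<open>v / (u + v)\<close>; so a maximum exists. If \<open>\<alpha> > 0\<close>, then near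
  the optimum the payoff equals \<open>ba (a_star \<beta>) - exp (u * (m - bm m)) * k \<beta>\<close>. Hence \<open>m - bm m\<close> is locally
  minimal, and the derivative with respect to \<open>\<beta>\<close> vanishes, which is the stated equation. This derivative is
  negative on \<open>[v / (u + v), 1)\<close>, which excludes this interval and also the kink \<open>\<beta> = 1\<close>.\<close>

subsection \<open>Concave functions on the half-line\<close>

lemma concave_halfline_tangent:
  fixes f :: "real \<Rightarrow> real"
  assumes "concave_on {0..} f" "f differentiable (at x)" "x > 0" "y \<ge> 0"
  shows "f y \<le> f x + deriv f x * (y - x)"
proof -
  have d: "(f has_real_derivative deriv f x) (at x)"
    using assms(2) by (simp add: DERIV_deriv_iff_real_differentiable)
  have "convex_on {0..} (\<lambda>x. - f x)"
    using assms(1) by (simp add: concave_on_def)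
  moreover have "((\<lambda>x. - f x) has_real_derivative - deriv f x) (at x within {0..})"
    by (rule DERIV_subset[OF DERIV_minus[OF d]]) simp
  ultimately have "- f y - - f x \<ge> - deriv f x * (y - x)"
    using assms(3,4) by (intro convex_on_imp_above_tangent[of "{0..}" _ x]) (auto simp: interior_Ici)
  then show ?thesis by simp
qed

text \<open>A tangent taken far enough out has slope below \<epsilon> and lies above the graph; its
  intercept serves as \<open>K\<close>.\<close>

lemma concave_halfline_sublinear:
  fixes f :: "real \<Rightarrow> real"
  assumes conc: "concave_on {0..} f" and diff: "\<And>x. x > 0 \<Longrightarrow> f differentiable (at x)"
    and lim: "(deriv f \<longlongrightarrow> 0) at_top" and "\<epsilon> > 0"
  obtains K where "\<And>x. x \<ge> 0 \<Longrightarrow> f x \<le> K + \<epsilon> * x"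
proof -
  have "eventually (\<lambda>x. deriv f x < \<epsilon> \<and> x > 0) at_top"
    using order_tendstoD(2)[OF lim \<open>\<epsilon> > 0\<close>] eventually_gt_at_top by (rule eventually_conj)
  then obtain X where X: "X > 0" "deriv f X < \<epsilon>"
    by (auto simp: eventually_at_top_linorder)
  show thesis
  proof
    fix x :: real assume "x \<ge> 0"
    have "f x \<le> f X + deriv f X * (x - X)"
      by (rule concave_halfline_tangent[OF conc diff]) (use X \<open>x \<ge> 0\<close> in auto)
    also have "\<dots> \<le> f X - deriv f X * X + \<epsilon> * x"
      using mult_right_mono[of "deriv f X" \<epsilon> x] X \<open>x \<ge> 0\<close> by (simp add: algebra_simps)
    finally show "f x \<le> f X - deriv f X * X + \<epsilon> * x" .
  qed
qed

lemma mono_on_halfline_deriv_nonneg: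
  fixes f :: "real \<Rightarrow> real"
  assumes "mono_on {0..} f" "x > 0" "f differentiable (at x)"
  shows "deriv f x \<ge> 0"
proof (rule ccontr)
  assume "\<not> deriv f x \<ge> 0"
  then obtain d where d: "d > 0" "\<And>t. 0 < t \<Longrightarrow> t < d \<Longrightarrow> f (x + t) < f x"
    using DERIV_neg_dec_right[of f "deriv f x" x] assms(3)
    by (auto simp: DERIV_deriv_iff_real_differentiable)
  have "f (x + d/2) < f x" using d by simp
  moreover have "f x \<le> f (x + d/2)"
    using assms d by (intro mono_onD[OF assms(1)]) auto
  ultimately show False by simp
qed

lemma isCont_eventually_greater:
  fixes f :: "real \<Rightarrow> real"
  assumes "isCont f x" "c < f x"
  shows "eventually (\<lambda>y. c < f y) (nhds x)"
  using assms order_tendstoD(1)[OF tendsto_at_iff_tendsto_nhds[THEN iffD1, of f x]]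
  by (simp add: isCont_def)

section \<open>Inada functions and the inverse of their derivative\<close>

locale inada =
  fixes f :: "real \<Rightarrow> real"
  assumes C1: "C1_halfline f"
    and strict: "strictly_concave_on {0..} f"
    and deriv_0: "filterlim (deriv f) at_top (at_right 0)"
    and deriv_inf: "(deriv f \<longlongrightarrow> 0) at_top"
begin

text \<open>The maximizer of \<open>s * f x - x\<close> for a price \<open>s > 0\<close>. Taking the
  price rather than the slope \<open>1 / s\<close> as argument gives a continuous function on the
  whole real line, equal to 0 for \<open>s \<le> 0\<close> because \<open>1 / 0\<close> is
  infinite.\<close>

definition resp :: "real \<Rightarrow> real" where
  "resp s = deriv_inv f (1 / ereal (max s 0))"

lemma cont: "continuous_on {0..} f"
  and diff: "x > 0 \<Longrightarrow> f differentiable (at x)"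
  and deriv_cont: "continuous_on {0<..} (deriv f)"
  using C1 by (auto simp: C1_halfline_def)

lemma has_deriv: "x > 0 \<Longrightarrow> (f has_real_derivative deriv f x) (at x)"
  using diff by (simp add: DERIV_deriv_iff_real_differentiable)

lemma concave: "concave_on {0..} f"
proof -
  have "convex_on {0..} (\<lambda>x. - f x)"
  proof
    fix t x y :: real assume *: "t > 0" "t < 1" "x \<in> {0..}" "y \<in> {0..}"
    show "- f ((1 - t) *\<^sub>R x + t *\<^sub>R y) \<le> (1 - t) * - f x + t * - f y"
    proof (cases "x = y")
      case True then show ?thesis by (simp add: algebra_simps)
    next
      case False
      then have "(1 - t) * f x + t * f y < f ((1 - t) * x + t * y)"
        using strict * unfolding strictly_concave_on_def by blast
      then show ?thesis by simp
    qed
  qed simp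
  then show ?thesis by (simp add: concave_on_def)
qed

lemma tangent: "x > 0 \<Longrightarrow> y \<ge> 0 \<Longrightarrow> f y \<le> f x + deriv f x * (y - x)"
  using concave_halfline_tangent[OF concave diff] by blast

text \<open>Strict concavity at the midpoint, followed by the weak tangent bound there.\<close>

lemma tangent_strict:
  assumes "x > 0" "y \<ge> 0" "x \<noteq> y"
  shows "f y < f x + deriv f x * (y - x)"
proof -
  let ?z = "(1 - 1/2) * x + 1/2 * y"
  have "(1 - 1/2) * f x + 1/2 * f y < f ?z"
    using strict[unfolded strictly_concave_on_def, THEN conjunct2, rule_format, of x y "1/2"] assms
    by simp
  moreover have "f ?z \<le> f x + deriv f x * (?z - x)"
    using assms by (intro tangent) auto
  ultimately show ?thesis by (simp add: field_simps)
qed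

lemma deriv_strict_antimono:
  assumes "0 < x" "x < y" shows "deriv f y < deriv f x"
proof -
  have "f y < f x + deriv f x * (y - x)" "f x < f y + deriv f y * (x - y)"
    using assms by (auto intro!: tangent_strict)
  then have "0 < (deriv f x - deriv f y) * (y - x)" by (simp add: algebra_simps)
  then show ?thesis using assms by (simp add: zero_less_mult_iff)
qed

lemma deriv_less_iff: "0 < x \<Longrightarrow> 0 < y \<Longrightarrow> deriv f x < deriv f y \<longleftrightarrow> y < x"
  using deriv_strict_antimono by (metis less_asym linorder_neqE_linordered_idom)

lemma deriv_pos:
  assumes "x > 0" shows "deriv f x > 0"
proof -
  have "eventually (\<lambda>y. deriv f y \<le> deriv f (x + 1)) at_top"
    using eventually_gt_at_top[of "x + 1"]
    by eventually_elim (use assms deriv_strict_antimono[of "x + 1"] in force)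
  then have "0 \<le> deriv f (x + 1)"
    by (rule tendsto_upperbound[OF deriv_inf]) simp
  also have "\<dots> < deriv f x" using assms by (intro deriv_strict_antimono) auto
  finally show ?thesis .
qed

lemma ex_deriv_eq:
  assumes "y > 0" obtains x where "x > 0" "deriv f x = y"
proof -
  have "eventually (\<lambda>x. deriv f x > y \<and> x > 0) (at_right 0)"
    using deriv_0 by (auto simp: filterlim_at_top_dense eventually_at_right_less intro!: eventually_conj)
  then obtain a where a: "a > 0" "deriv f a > y"
    using eventually_happens' trivial_limit_at_right_real by blast
  have "eventually (\<lambda>x. deriv f x < y \<and> x > a) at_top"
    using order_tendstoD(2)[OF deriv_inf assms] eventually_gt_at_top by (rule eventually_conj)
  then obtain b where b: "a < b" "deriv f b < y"
    by (auto simp: eventually_at_top_linorder)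
  have "continuous_on {a..b} (deriv f)"
    using deriv_cont by (rule continuous_on_subset) (use a in auto)
  then obtain x where "a \<le> x" "deriv f x = y"
    using IVT2'[of "deriv f" b y a] a b by auto
  with a show thesis by (intro that[of x]) auto
qed

lemma resp_nonpos: "s \<le> 0 \<Longrightarrow> resp s = 0"
  by (auto simp: resp_def deriv_inv_def deriv_level_def max_def)

lemma deriv_inv_pos:
  assumes "y > 0"
  shows "deriv_inv f (ereal y) > 0" "deriv f (deriv_inv f (ereal y)) = y"
proof -
  obtain x where "x > 0" "deriv f x = y" using ex_deriv_eq[OF assms] .
  then have "x \<in> deriv_level f (ereal y)" by (auto simp: deriv_level_def)
  then have "deriv_inv f (ereal y) \<in> deriv_level f (ereal y)"
    unfolding deriv_inv_def by (rule someI)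
  then show "deriv_inv f (ereal y) > 0" "deriv f (deriv_inv f (ereal y)) = y"
    by (auto simp: deriv_level_def)
qed

lemma resp_pos:
  assumes "s > 0" shows "resp s > 0" and deriv_resp: "deriv f (resp s) = 1 / s"
proof -
  have "1 / ereal (max s 0) = ereal (1 / s)"
    using assms by (simp add: one_ereal_def max_def)
  then show "resp s > 0" "deriv f (resp s) = 1 / s"
    using deriv_inv_pos[of "1 / s"] assms by (auto simp: resp_def)
qed

lemma resp_nonneg: "resp s \<ge> 0"
  using resp_pos(1)[of s] resp_nonpos[of s] by linarith

text \<open>This and the next equivalence trade a comparison of \<open>resp s\<close> with
  \<open>x\<close> for one of \<open>s\<close> with the threshold \<open>1 / deriv f x\<close>. They
  also hold for \<open>s \<le> 0\<close>, so continuity at 0 needs no separate limit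
  argument.\<close>

lemma resp_less_iff:
  assumes "x > 0" shows "resp s < x \<longleftrightarrow> s < 1 / deriv f x"
proof (cases "s > 0")
  case True
  have "resp s < x \<longleftrightarrow> deriv f x < 1 / s"
    using deriv_less_iff[OF assms resp_pos(1)[OF True]] deriv_resp[OF True] by simp
  also have "\<dots> \<longleftrightarrow> s < 1 / deriv f x"
    using True deriv_pos[OF assms] by (simp add: field_simps)
  finally show ?thesis .
next
  case False
  have "1 / deriv f x > 0" using deriv_pos[OF assms] by simp
  moreover have "resp s = 0" using False by (simp add: resp_nonpos)
  ultimately show ?thesis using False assms by linarith
qed

lemma less_resp_iff:
  assumes "x > 0" shows "x < resp s \<longleftrightarrow> 1 / deriv f x < s"
proof (cases "s > 0")
  case True
  have "x < resp s \<longleftrightarrow> 1 / s < deriv f x"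
    using deriv_less_iff[OF resp_pos(1)[OF True] assms] deriv_resp[OF True] by simp
  also have "\<dots> \<longleftrightarrow> 1 / deriv f x < s"
    using True deriv_pos[OF assms] by (simp add: field_simps)
  finally show ?thesis .
next
  case False
  have "1 / deriv f x > 0" using deriv_pos[OF assms] by simp
  moreover have "resp s = 0" using False by (simp add: resp_nonpos)
  ultimately show ?thesis using False assms by linarith
qed

lemma resp_deriv: "x > 0 \<Longrightarrow> resp (1 / deriv f x) = x"
  using resp_less_iff less_resp_iff by (metis less_irrefl linorder_neqE_linordered_idom)

lemma isCont_resp: "isCont resp s"
  unfolding isCont_def
proof (rule order_tendstoI)
  fix a assume a: "a < resp s"
  show "eventually (\<lambda>s. a < resp s) (at s)"
  proof (cases "a < 0")
    case True
    then show ?thesis using resp_nonneg by (auto intro!: always_eventually less_le_trans[of a 0])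
  next
    case False
    \<comment> \<open>The midpoint is positive even when \<open>a = 0\<close>, as
      \<open>less_resp_iff\<close> demands.\<close>
    define a' where "a' = (a + resp s) / 2"
    have a': "a < a'" "a' < resp s" "a' > 0" using a False by (auto simp: a'_def)
    have "eventually (\<lambda>t. 1 / deriv f a' < t) (at s)"
      using a' less_resp_iff[of a' s] by (intro order_tendstoD(1)[OF tendsto_ident_at]) auto
    then show ?thesis
      proof eventually_elim
      case (elim t)
      then have "a' < resp t" using a' less_resp_iff[of a' t] by simp
      then show ?case using a' by simp
    qed
  qed
next
  fix b assume b: "resp s < b"
  then have "b > 0" using resp_nonneg[of s] by linarith
  then have "eventually (\<lambda>t. t < 1 / deriv f b) (at s)"
    using b resp_less_iff[of b s] by (intro order_tendstoD(2)[OF tendsto_ident_at]) auto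
  then show "eventually (\<lambda>t. resp t < b) (at s)"
    by eventually_elim (use \<open>b > 0\<close> resp_less_iff[of b] in force)
qed

lemma continuous_on_resp [continuous_intros]:
  "continuous_on A h \<Longrightarrow> continuous_on A (\<lambda>x. resp (h x))"
  by (rule continuous_on_compose2[of UNIV resp])
     (auto simp: isCont_resp continuous_at_imp_continuous_on)

lemma continuous_on_f_resp [continuous_intros]:
  "continuous_on A h \<Longrightarrow> continuous_on A (\<lambda>x. f (resp (h x)))"
  by (rule continuous_on_compose2[OF cont]) (auto intro: continuous_intros resp_nonneg)

lemma resp_at_top: "filterlim resp at_top at_top"
  unfolding filterlim_at_top
proof
  fix Z :: real
  have "eventually (\<lambda>s. 1 / deriv f (max Z 1) < s) at_top" by (rule eventually_gt_at_top)
  then show "eventually (\<lambda>s. Z \<le> resp s) at_top"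
    proof eventually_elim
    case (elim s)
    then have "max Z 1 < resp s" using less_resp_iff[of "max Z 1" s] by simp
    then show ?case by simp
  qed
qed

text \<open>For \<open>s > 0\<close> the tangent at \<open>resp s\<close> has slope
  \<open>1 / s\<close>. For \<open>s \<le> 0\<close> a larger \<open>x\<close> costs more and,
  \<open>f\<close> being increasing, earns no more.\<close>

lemma resp_optimal:
  assumes "x \<ge> 0" and "s > 0 \<or> mono_on {0..} f"
  shows "s * f x - x \<le> s * f (resp s) - resp s"
proof (cases "s > 0")
  case True
  have "f x \<le> f (resp s) + 1 / s * (x - resp s)"
    using tangent[OF resp_pos(1)[OF True] assms(1)] deriv_resp[OF True] by simp
  then have "s * f x \<le> s * (f (resp s) + 1 / s * (x - resp s))"
    using True by (intro mult_left_mono) auto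
  also have "\<dots> = s * f (resp s) + (x - resp s)" using True by (simp add: algebra_simps)
  finally show ?thesis by simp
next
  case False
  then have "f 0 \<le> f x" using assms by (auto intro: mono_onD)
  with False have "s * f x \<le> s * f 0" by (intro mult_left_mono_neg) auto
  with False assms show ?thesis by (simp add: resp_nonpos)
qed

text \<open>\<open>resp\<close> inverts \<open>\<lambda>x. 1 / deriv f x\<close>, so the inverse
  function rule applies; \<open>deriv (deriv f) (resp s) < 0\<close> keeps the slope to be inverted
  nonzero.\<close>

lemma DERIV_resp:
  assumes "s > 0" and "deriv f differentiable (at (resp s))" and "deriv (deriv f) (resp s) < 0"
  shows "(resp has_real_derivative - 1 / (s\<^sup>2 * deriv (deriv f) (resp s))) (at s)"
proof -
  let ?c = "deriv (deriv f) (resp s)"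
  have "(deriv f has_real_derivative ?c) (at (resp s))"
    using assms(2) by (simp add: DERIV_deriv_iff_real_differentiable)
  then have "((\<lambda>x. inverse (deriv f x)) has_real_derivative
      - (inverse (deriv f (resp s)) * ?c * inverse (deriv f (resp s)))) (at (resp s))"
    using deriv_resp[OF assms(1)] assms(1) by (intro DERIV_inverse') auto
  then have "((\<lambda>x. inverse (deriv f x)) has_real_derivative - (s\<^sup>2 * ?c)) (at (resp s))"
    by (simp add: deriv_resp[OF assms(1)] power2_eq_square mult_ac)
  then have "(resp has_real_derivative inverse (- (s\<^sup>2 * ?c))) (at s)"
    by (rule DERIV_inverse_function[where a = 0 and b = "s + 1"])
       (use assms deriv_resp isCont_resp in auto)
  then show ?thesis by (simp add: divide_inverse)
qed

end

subsection \<open>Moment generating functions\<close>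

lemma abs_exp_minus_1_le: "\<bar>exp y - 1\<bar> \<le> \<bar>y\<bar> * exp \<bar>y\<bar>" for y :: real
proof (cases "y \<ge> 0")
  case True
  have "exp y * (1 - y) \<le> exp y * exp (- y)"
    using exp_ge_add_one_self[of "- y"] by (intro mult_left_mono) auto
  then have "exp y - 1 \<le> y * exp y" by (simp add: exp_minus algebra_simps)
  with True show ?thesis by simp
next
  case False
  have "1 - exp y \<le> - y" using exp_ge_add_one_self[of y] by linarith
  also have "\<dots> \<le> \<bar>y\<bar> * exp \<bar>y\<bar>" using False by (simp add: mult_le_cancel_left1)
  finally show ?thesis using False by simp
qed

text \<open>The factor \<open>\<bar>x\<bar>\<close> is absorbed by raising the exponent by 1, and
  the sign of \<open>x\<close> by adding both exponentials. The bound is uniform in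
  \<open>s\<close>, and integrable as soon as all exponential moments exist.\<close>

lemma abs_mult_exp_le:
  fixes x s t B :: real
  assumes "\<bar>s\<bar> \<le> B"
  shows "exp (t * x) * (\<bar>x\<bar> * exp \<bar>s * x\<bar>) \<le> exp ((t + (B + 1)) * x) + exp ((t - (B + 1)) * x)"
proof -
  have "\<bar>x\<bar> * exp \<bar>s * x\<bar> \<le> exp \<bar>x\<bar> * exp (B * \<bar>x\<bar>)"
    using assms exp_ge_add_one_self[of "\<bar>x\<bar>"] 
    by (intro mult_mono) (auto simp: abs_mult intro: mult_right_mono order_trans[of _ "1 + \<bar>x\<bar>"])
  also have "\<dots> = exp ((B + 1) * \<bar>x\<bar>)" by (simp add: exp_add[symmetric] algebra_simps)
  also have "\<dots> \<le> exp ((B + 1) * x) + exp (- ((B + 1) * x))"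
    by (cases "x \<ge> 0") (simp_all add: add_increasing add_increasing2)
  finally have "exp (t * x) * (\<bar>x\<bar> * exp \<bar>s * x\<bar>) \<le>
      exp (t * x) * (exp ((B + 1) * x) + exp (- ((B + 1) * x)))"
    by (rule mult_left_mono) simp
  also have "\<dots> = exp ((t + (B + 1)) * x) + exp ((t - (B + 1)) * x)"
    by (simp add: distrib_left exp_add[symmetric] algebra_simps)
  finally show ?thesis .
qed

context prob_space
begin

lemma integrable_mult_exp:
  fixes X :: "'a \<Rightarrow> real"
  assumes [measurable]: "random_variable borel X"
    and "\<And>t. integrable M (\<lambda>\<omega>. exp (t * X \<omega>))"
  shows "integrable M (\<lambda>\<omega>. X \<omega> * exp (t * X \<omega>))"
proof (rule Bochner_Integration.integrable_bound)
  \<comment> \<open>The form \<open>0 + 1\<close> is \<open>B + 1\<close> of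
    \<open>abs_mult_exp_le\<close> at \<open>B = 0\<close>, used with \<open>s = 0\<close>.\<close>
  show "integrable M (\<lambda>\<omega>. exp ((t + (0 + 1)) * X \<omega>) + exp ((t - (0 + 1)) * X \<omega>))"
    by (intro Bochner_Integration.integrable_add assms)
  show "AE \<omega> in M. norm (X \<omega> * exp (t * X \<omega>)) \<le>
      norm (exp ((t + (0 + 1)) * X \<omega>) + exp ((t - (0 + 1)) * X \<omega>))"
    using abs_mult_exp_le[of 0 0 t] by (intro AE_I2) (simp add: abs_mult mult.commute[of "\<bar>X _\<bar>"])
qed measurable

text \<open>Differentiation under the expectation by dominated convergence, along an arbitrary null
  sequence of increments.\<close>

lemma DERIV_mgf:
  fixes X :: "'a \<Rightarrow> real"
  assumes [measurable]: "random_variable borel X"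
    and int: "\<And>t. integrable M (\<lambda>\<omega>. exp (t * X \<omega>))"
  shows "((\<lambda>t. expectation (\<lambda>\<omega>. exp (t * X \<omega>))) has_real_derivative
      expectation (\<lambda>\<omega>. X \<omega> * exp (t * X \<omega>))) (at t)"
  unfolding DERIV_def tendsto_at_iff_sequentially
proof (intro allI impI)
  fix Y :: "nat \<Rightarrow> real"
  assume Y: "\<forall>i. Y i \<in> UNIV - {0}" "Y \<longlonglongrightarrow> 0"
  then have nz: "Y n \<noteq> 0" for n by auto
  \<comment> \<open>A null sequence is bounded, so one dominating function serves all difference
    quotients.\<close>
  obtain B where B: "\<And>n. \<bar>Y n\<bar> \<le> B"
    using Y(2) convergent_imp_Bseq[of Y] by (auto simp: convergent_def Bseq_def)
  define q where "q n \<omega> = (exp ((t + Y n) * X \<omega>) - exp (t * X \<omega>)) / Y n" for n \<omega>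
  have "(\<lambda>n. expectation (q n)) \<longlonglongrightarrow> expectation (\<lambda>\<omega>. X \<omega> * exp (t * X \<omega>))"
  proof (rule integral_dominated_convergence)
    show "integrable M (\<lambda>\<omega>. exp ((t + (B + 1)) * X \<omega>) + exp ((t - (B + 1)) * X \<omega>))"
      by (intro Bochner_Integration.integrable_add int)
    show "AE \<omega> in M. (\<lambda>n. q n \<omega>) \<longlonglongrightarrow> X \<omega> * exp (t * X \<omega>)"
    proof (rule AE_I2)
      fix \<omega>
      have "((\<lambda>s. exp (s * X \<omega>)) has_real_derivative X \<omega> * exp (t * X \<omega>)) (at t)"
        by (auto intro!: derivative_eq_intros)
      then have "((\<lambda>s. (exp ((t + s) * X \<omega>) - exp (t * X \<omega>)) / s) \<circ> Y)
          \<longlonglongrightarrow> X \<omega> * exp (t * X \<omega>)"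
        using Y unfolding DERIV_def tendsto_at_iff_sequentially by blast
      then show "(\<lambda>n. q n \<omega>) \<longlonglongrightarrow> X \<omega> * exp (t * X \<omega>)"
        by (simp add: q_def o_def)
    qed
    show "AE \<omega> in M. norm (q n \<omega>) \<le> exp ((t + (B + 1)) * X \<omega>) + exp ((t - (B + 1)) * X \<omega>)" for n
    proof (rule AE_I2)
      fix \<omega>
      have "q n \<omega> = exp (t * X \<omega>) * ((exp (Y n * X \<omega>) - 1) / Y n)"
        by (simp add: q_def distrib_right exp_add algebra_simps diff_divide_distrib)
      then have "norm (q n \<omega>) = exp (t * X \<omega>) * (\<bar>exp (Y n * X \<omega>) - 1\<bar> / \<bar>Y n\<bar>)"
        by (simp add: abs_mult)
      also have "\<dots> \<le> exp (t * X \<omega>) * (\<bar>X \<omega>\<bar> * exp \<bar>Y n * X \<omega>\<bar>)"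
        using abs_exp_minus_1_le[of "Y n * X \<omega>"] nz[of n]
        by (intro mult_left_mono) (auto simp: field_simps abs_mult)
      also have "\<dots> \<le> exp ((t + (B + 1)) * X \<omega>) + exp ((t - (B + 1)) * X \<omega>)"
        by (rule abs_mult_exp_le[OF B])
      finally show "norm (q n \<omega>) \<le> \<dots>" .
    qed
  qed (auto simp: q_def[abs_def])
  moreover have "expectation (q n) =
      (expectation (\<lambda>\<omega>. exp ((t + Y n) * X \<omega>)) - expectation (\<lambda>\<omega>. exp (t * X \<omega>))) / Y n" for n
    unfolding q_def by (simp add: int)
  ultimately show "((\<lambda>s. (expectation (\<lambda>\<omega>. exp ((t + s) * X \<omega>)) - expectation (\<lambda>\<omega>. exp (t * X \<omega>))) / s) \<circ> Y)
      \<longlonglongrightarrow> expectation (\<lambda>\<omega>. X \<omega> * exp (t * X \<omega>))"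
    by (simp add: o_def)
qed

lemma expectation_pos:
  fixes X :: "'a \<Rightarrow> real"
  assumes "integrable M X" "\<And>\<omega>. X \<omega> \<ge> 0" "\<not> (AE \<omega> in M. X \<omega> = 0)"
  shows "expectation X > 0"
  using assms integral_nonneg_eq_0_iff_AE[of M X] Bochner_Integration.integral_nonneg[of M X]
  by (force simp: less_le)

lemma mgf_pos:
  fixes X :: "'a \<Rightarrow> real"
  assumes "integrable M (\<lambda>\<omega>. exp (t * X \<omega>))"
  shows "expectation (\<lambda>\<omega>. exp (t * X \<omega>)) > 0"
  using assms by (intro expectation_pos) auto

text \<open>With \<open>c\<close> the tilted mean at \<open>s\<close>, the claim is the positivity of the expectation of
  \<open>(X - c) * (exp ((t - s) * (X - c)) - 1) * exp (s * X)\<close>, whose integrand is nonnegative.\<close>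

lemma tilted_mean_strict_mono:
  fixes X :: "'a \<Rightarrow> real"
  assumes rv: "random_variable borel X"
    and int: "\<And>t. integrable M (\<lambda>\<omega>. exp (t * X \<omega>))"
    and nonconst: "\<not> (\<exists>c. AE \<omega> in M. X \<omega> = c)" and "s < t"
  shows "expectation (\<lambda>\<omega>. X \<omega> * exp (s * X \<omega>)) / expectation (\<lambda>\<omega>. exp (s * X \<omega>))
       < expectation (\<lambda>\<omega>. X \<omega> * exp (t * X \<omega>)) / expectation (\<lambda>\<omega>. exp (t * X \<omega>))"
proof -
  define m where "m t = expectation (\<lambda>\<omega>. exp (t * X \<omega>))" for t
  define m' where "m' t = expectation (\<lambda>\<omega>. X \<omega> * exp (t * X \<omega>))" for t
  define c where "c = m' s / m s"
  define w where "w = exp (- (t - s) * c)"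
  have pos: "m t > 0" for t unfolding m_def using int by (rule mgf_pos)
  note int' = integrable_mult_exp[OF rv int]
  let ?Z = "\<lambda>\<omega>. (X \<omega> - c) * (exp ((t - s) * (X \<omega> - c)) - 1) * exp (s * X \<omega>)"
  have Z: "?Z \<omega> = w * (X \<omega> * exp (t * X \<omega>)) - w * c * exp (t * X \<omega>)
      - X \<omega> * exp (s * X \<omega>) + c * exp (s * X \<omega>)" for \<omega>
  proof -
    have "exp ((t - s) * (X \<omega> - c)) * exp (s * X \<omega>) = w * exp (t * X \<omega>)"
      by (simp add: w_def exp_add[symmetric] algebra_simps)
    then show ?thesis by algebra
  qed
  have "expectation ?Z > 0"
  proof (rule expectation_pos)
    show "integrable M ?Z" unfolding Z using int int' by auto
    show "?Z \<omega> \<ge> 0" for \<omega>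
      using \<open>s < t\<close> by (auto simp: zero_le_mult_iff mult_le_0_iff)
    show "\<not> (AE \<omega> in M. ?Z \<omega> = 0)"
      using nonconst \<open>s < t\<close> by auto
  qed
  also have "expectation ?Z = w * m' t - w * c * m t - m' s + c * m s"
    unfolding Z using int int' by (simp add: m_def m'_def)
  \<comment> \<open>The choice of \<open>c\<close> cancels the last two terms.\<close>
  also have "\<dots> = w * (m' t - c * m t)"
    using pos[of s] by (simp add: c_def algebra_simps)
  finally have "m' t - c * m t > 0" by (simp add: zero_less_mult_iff w_def)
  then have "c < m' t / m t" using pos[of t] by (simp add: field_simps)
  then show ?thesis by (simp add: c_def m_def m'_def)
qed

end

subsection \<open>The reduced problem of the leader\<close>

context situation1
begin

sublocale phi: inada \<phi>
  by unfold_locales (fact phi_C1 phi_concave phi_deriv_0 phi_deriv_infinity)+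

sublocale psi: inada \<psi>
  by unfold_locales (fact psi_C1 psi_concave psi_deriv_0 psi_deriv_infinity)+

sublocale gain: inada g
  by unfold_locales (fact g_C1 g_concave g_deriv_0 g_deriv_infinity)+

lemma e_star_eq: "e_star \<beta> = phi.resp (1 - \<beta>)"
  by (simp add: e_star_def phi.resp_def)

lemma a_star_eq: "a_star \<beta> = psi.resp (\<delta> * (1 - \<beta>) / (1 + r))"
proof (cases "\<delta> * (1 - \<beta>) > 0")
  case True
  then have "\<delta> * (1 - \<beta>) / (1 + r) > 0" using r_nonneg by simp
  with True show ?thesis
    using r_nonneg by (simp add: a_star_def psi.resp_def one_ereal_def max_absorb1)
next
  case False
  \<comment> \<open>Both sides are 0: the quotient by the truncated denominator is infinite, and
    infinite slope is attained at 0 by convention.\<close>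
  then have "max (\<delta> * (1 - \<beta>)) 0 = 0" by simp
  moreover have "\<delta> * (1 - \<beta>) / (1 + r) \<le> 0"
    using False r_nonneg by (simp add: divide_nonpos_pos)
  ultimately show ?thesis
    using r_nonneg by (simp add: a_star_def psi.resp_nonpos deriv_inv_def deriv_level_def)
qed

lemma m_star_eq: "\<gamma> \<ge> 0 \<Longrightarrow> m_star \<gamma> = gain.resp \<gamma>"
  by (simp add: m_star_def gain.resp_def)

lemma e_star_nonneg: "e_star \<beta> \<ge> 0" and a_star_nonneg: "a_star \<beta> \<ge> 0"
  by (simp_all add: e_star_eq a_star_eq phi.resp_nonneg psi.resp_nonneg)

lemma continuous_on_stars:
  "continuous_on A e_star" "continuous_on A a_star"
  "continuous_on A (\<lambda>\<beta>. \<phi> (e_star \<beta>))" "continuous_on A (\<lambda>\<beta>. \<psi> (a_star \<beta>))"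
  "continuous_on A (\<lambda>\<beta>. be (e_star \<beta>))" "continuous_on A (\<lambda>\<beta>. ba (a_star \<beta>))"
proof -
  show e: "continuous_on A e_star" and a: "continuous_on A a_star"
    and "continuous_on A (\<lambda>\<beta>. \<phi> (e_star \<beta>))" "continuous_on A (\<lambda>\<beta>. \<psi> (a_star \<beta>))"
    unfolding e_star_eq a_star_eq by (intro continuous_intros; use r_nonneg in simp)+
  show "continuous_on A (\<lambda>\<beta>. be (e_star \<beta>))"
    by (rule continuous_on_compose2[OF _ e, of "{0..}"])
       (use be_C1 e_star_nonneg in \<open>auto simp: C1_halfline_def\<close>)
  show "continuous_on A (\<lambda>\<beta>. ba (a_star \<beta>))"
    by (rule continuous_on_compose2[OF _ a, of "{0..}"])
       (use ba_C1 a_star_nonneg in \<open>auto simp: C1_halfline_def\<close>)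
qed

section \<open>The cumulant generating function of \<mu>\<close>

definition mgf :: "real \<Rightarrow> real" where "mgf t = expectation (\<lambda>\<omega>. exp (t * \<mu> \<omega>))"

definition cgf :: "real \<Rightarrow> real" where "cgf t = ln (mgf t)"

lemma mgf_gt_0: "mgf t > 0"
  unfolding mgf_def by (rule mgf_pos[OF mu_exp_moments])

lemma exp_cgf: "exp (cgf t) = mgf t"
  by (simp add: cgf_def mgf_gt_0)

lemma DERIV_cgf: "(cgf has_real_derivative h t) (at t)"
proof -
  have "(mgf has_real_derivative expectation (\<lambda>\<omega>. \<mu> \<omega> * exp (t * \<mu> \<omega>))) (at t)"
    unfolding mgf_def[abs_def] by (rule DERIV_mgf[OF mu_rv mu_exp_moments])
  from DERIV_chain2[OF DERIV_ln_divide[OF mgf_gt_0] this] show ?thesis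
    by (simp add: cgf_def[abs_def] h_def mgf_def)
qed

lemma continuous_on_cgf [continuous_intros]:
  "continuous_on A f \<Longrightarrow> continuous_on A (\<lambda>x. cgf (f x))"
  by (rule continuous_on_compose2[of UNIV cgf])
     (auto intro: DERIV_isCont DERIV_cgf continuous_at_imp_continuous_on)

lemma h_strict_mono: "s < t \<Longrightarrow> h s < h t"
  unfolding h_def by (rule tilted_mean_strict_mono[OF mu_rv mu_exp_moments mu_nonconst])

section \<open>Closed forms of the payoffs\<close>

lemma expectation_exp_affine: "expectation (\<lambda>\<omega>. exp (c + t * \<mu> \<omega>)) = exp (c + cgf t)"
  by (simp add: exp_add exp_cgf mgf_def)

lemma integrable_exp_affine: "integrable M (\<lambda>\<omega>. exp (c + t * \<mu> \<omega>))"
  using mu_exp_moments by (simp add: exp_add)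

lemma expectation_exp_centered: "expectation (\<lambda>\<omega>. exp (t * (\<mu> \<omega> - c))) = exp (cgf t - t * c)"
  using expectation_exp_affine[of "- t * c" t] by (simp add: algebra_simps)

text \<open>\<open>V\<close> is exponential and its argument affine in \<mu>, so the expectation is
  an exponential of \<open>cgf\<close>. The terms are grouped so that each of \<open>e\<close>,
  \<open>a\<close> and \<open>m\<close> occurs in one bracket only.\<close>

lemma J1_eq: "J1 \<alpha> \<beta> \<gamma> a e m = - exp (- v * (\<alpha> + ((1 - \<beta>) * \<phi> e - e) +
    ((1 - \<beta>) * \<delta> * \<psi> a - (1 + r) * a) + (\<gamma> * g m - m) - (1 + r) * D - cgf (v * (1 - \<beta>)) / v))"
  (is "_ = - exp (- v * (?c - cgf ?t / v))")
proof -
  have "J1 \<alpha> \<beta> \<gamma> a e m = expectation (\<lambda>\<omega>. - exp (- v * ?c + ?t * \<mu> \<omega>))"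
    unfolding J1_def V_def Cop_def
    by (intro arg_cong[where f = expectation] ext) (simp add: algebra_simps)
  also have "\<dots> = - exp (- v * ?c + cgf ?t)"
    unfolding Bochner_Integration.integral_minus expectation_exp_affine ..
  finally show ?thesis using v_pos by (simp add: algebra_simps)
qed

lemma I1_eq: "I1 \<alpha> \<beta> \<gamma> a e m = ba a - exp (u * (\<alpha> + \<gamma> * g m - bm m - be e - \<beta> * \<phi> e
    - \<beta> * \<delta> * \<psi> a + cgf (u * \<beta>) / u))"
  (is "_ = _ - exp (u * (?c + cgf ?t / u))")
proof -
  have "I1 \<alpha> \<beta> \<gamma> a e m = expectation (\<lambda>\<omega>. ba a - exp (u * ?c + ?t * \<mu> \<omega>))"
    unfolding I1_def U_def Cop_def
    by (intro arg_cong[where f = expectation] ext) (simp add: algebra_simps)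
  also have "\<dots> = ba a - exp (u * ?c + cgf ?t)"
    using integrable_exp_affine by (simp add: expectation_exp_affine prob_space)
  finally show ?thesis using u_pos by (simp add: algebra_simps)
qed

lemma C_eq: "C \<beta> = cgf (v * (1 - \<beta>)) / v - (1 - \<beta>) * \<phi> (e_star \<beta>)"
  unfolding C_def expectation_exp_centered using v_pos by (simp add: field_simps)

text \<open>The participation constraint reads \<open>\<alpha> \<ge> reserve \<beta> - surplus \<gamma>\<close>.\<close>

definition reserve :: "real \<Rightarrow> real" where
  "reserve \<beta> = C \<beta> + e_star \<beta> + (1 + r) * (D + a_star \<beta>) - (1 - \<beta>) * \<delta> * \<psi> (a_star \<beta>)"

definition surplus :: "real \<Rightarrow> real" where
  "surplus \<gamma> = \<gamma> * g (gain.resp \<gamma>) - gain.resp \<gamma>"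

lemma J1_best_response:
  assumes "\<gamma> \<ge> 0"
  shows "J1 \<alpha> \<beta> \<gamma> (a_star \<beta>) (e_star \<beta>) (m_star \<gamma>) = - exp (- v * (\<alpha> - (reserve \<beta> - surplus \<gamma>)))"
  using assms by (simp add: J1_eq reserve_def surplus_def C_eq m_star_eq algebra_simps)

lemma feasible_iff: "feasible \<alpha> \<beta> \<gamma> \<longleftrightarrow> \<alpha> \<ge> 0 \<and> \<gamma> \<ge> 0 \<and> reserve \<beta> - surplus \<gamma> \<le> \<alpha>"
proof (cases "\<gamma> \<ge> 0")
  case True
  then show ?thesis
    using v_pos by (auto simp: feasible_def J1_best_response V_def zero_le_mult_iff)
qed (auto simp: feasible_def)

text \<open>By \<open>J1_eq\<close> the three controls enter through separate brackets, and each
  bracket is an instance of \<open>resp_optimal\<close>.\<close>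

lemma best_response_optimal:
  assumes "\<gamma> > 0" "a \<ge> 0" "e \<ge> 0" "m \<ge> 0"
  shows "J1 \<alpha> \<beta> \<gamma> a e m \<le> J1 \<alpha> \<beta> \<gamma> (a_star \<beta>) (e_star \<beta>) (m_star \<gamma>)"
proof -
  have "(1 - \<beta>) * \<phi> e - e \<le> (1 - \<beta>) * \<phi> (e_star \<beta>) - e_star \<beta>"
    unfolding e_star_eq using assms phi_mono by (intro phi.resp_optimal) auto
  moreover have "\<gamma> * g m - m \<le> \<gamma> * g (m_star \<gamma>) - m_star \<gamma>"
    using assms by (simp add: m_star_eq gain.resp_optimal)
  moreover have "(1 - \<beta>) * \<delta> * \<psi> a - (1 + r) * a \<le> (1 - \<beta>) * \<delta> * \<psi> (a_star \<beta>) - (1 + r) * a_star \<beta>"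
  proof -
    \<comment> \<open>Factoring out \<open>1 + r\<close> brings the bracket in \<open>a\<close> to
      the form \<open>s * \<psi> a - a\<close>.\<close>
    have "(1 + r) * (\<delta> * (1 - \<beta>) / (1 + r) * \<psi> a - a)
        \<le> (1 + r) * (\<delta> * (1 - \<beta>) / (1 + r) * \<psi> (a_star \<beta>) - a_star \<beta>)"
      unfolding a_star_eq using assms r_nonneg psi_mono
      by (intro mult_left_mono psi.resp_optimal) auto
    moreover have "(1 + r) * (\<delta> * (1 - \<beta>) / (1 + r) * y - x) = (1 - \<beta>) * \<delta> * y - (1 + r) * x" for x y
      using r_nonneg by (simp add: right_diff_distrib) (simp add: algebra_simps)
    ultimately show ?thesis by simp
  qed
  ultimately show ?thesis
    unfolding J1_eq using v_pos by simp
qed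

text \<open>Sum of the entropic risk costs of the two shares \<open>(1 - \<beta>) * \<mu>\<close>
  and \<open>\<beta> * \<mu>\<close>, for risk aversions \<open>v\<close> and
  \<open>u\<close>.\<close>

definition cumul :: "real \<Rightarrow> real" where
  "cumul \<beta> = cgf (v * (1 - \<beta>)) / v + cgf (u * \<beta>) / u"

text \<open>The shares \<open>1 - \<beta>\<close> and \<open>\<beta>\<close> of
  \<open>\<phi>\<close> add up to \<open>\<phi>\<close>, so \<beta> enters only through
  \<open>e_star\<close>, \<open>a_star\<close> and \<open>cumul\<close>.\<close>

definition log_k :: "real \<Rightarrow> real" where
  "log_k \<beta> = (e_star \<beta> - be (e_star \<beta>) - \<phi> (e_star \<beta>)) +
     ((1 + r) * a_star \<beta> - \<delta> * \<psi> (a_star \<beta>)) + (1 + r) * D + cumul \<beta>"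

lemma k_eq: "k \<beta> = exp (u * log_k \<beta>)"
proof -
  have "expectation (\<lambda>\<omega>. exp (u * \<beta> * (\<mu> \<omega> - \<phi> (e_star \<beta>)))) =
      exp (cgf (u * \<beta>) - u * \<beta> * \<phi> (e_star \<beta>))"
    by (rule expectation_exp_centered)
  then show ?thesis
    using u_pos by (simp add: k_def log_k_def cumul_def C_eq exp_add[symmetric] algebra_simps)
qed

text \<open>With \<alpha> measured from the participation bound, the payment
  \<open>\<gamma> * g m\<close> cancels. What is left of \<gamma> is the net cost
  \<open>m - bm m\<close>, in a factor separate from \<beta>.\<close>

lemma I1_leader_eq:
  assumes "\<gamma> \<ge> 0"
  shows "I1_leader \<alpha> \<beta> \<gamma> = ba (a_star \<beta>) -
    exp (u * (\<alpha> - (reserve \<beta> - surplus \<gamma>))) * exp (u * (gain.resp \<gamma> - bm (gain.resp \<gamma>))) * k \<beta>"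
  using assms u_pos
  by (simp add: I1_leader_def I1_eq k_eq log_k_def cumul_def reserve_def surplus_def C_eq m_star_eq
      exp_add[symmetric] algebra_simps)

lemma I1_leader_binding:
  assumes "\<gamma> \<ge> 0"
  shows "I1_leader (reserve \<beta> - surplus \<gamma>) \<beta> \<gamma> =
    ba (a_star \<beta>) - exp (u * (gain.resp \<gamma> - bm (gain.resp \<gamma>))) * k \<beta>"
  using I1_leader_eq[OF assms] by simp

lemma I1_leader_less_iff:
  "\<gamma> \<ge> 0 \<Longrightarrow> I1_leader \<alpha> \<beta> \<gamma> < I1_leader \<alpha>' \<beta> \<gamma> \<longleftrightarrow> \<alpha>' < \<alpha>"
  using u_pos by (simp add: I1_leader_eq k_eq)

lemma continuous_on_reserve: "continuous_on A reserve"
  unfolding reserve_def[abs_def] C_eq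
  by (intro continuous_intros continuous_on_stars) (use v_pos in auto)

lemma continuous_on_surplus: "continuous_on A surplus"
  unfolding surplus_def[abs_def] by (intro continuous_intros)

lemma continuous_on_bm_resp: "continuous_on A (\<lambda>\<gamma>. bm (gain.resp \<gamma>))"
  by (rule continuous_on_compose2[of "{0..}" bm])
     (use bm_C1 gain.resp_nonneg in \<open>auto simp: C1_halfline_def intro: continuous_intros\<close>)

lemma continuous_on_cumul: "continuous_on A cumul"
  unfolding cumul_def[abs_def] by (intro continuous_intros) (use u_pos v_pos in auto)

lemma continuous_on_log_k: "continuous_on A log_k"
  unfolding log_k_def[abs_def] by (intro continuous_intros continuous_on_stars continuous_on_cumul)

section \<open>Convexity and growth of the risk-sharing cost\<close>

definition cumul' :: "real \<Rightarrow> real" where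
  "cumul' \<beta> = h (u * \<beta>) - h (v * (1 - \<beta>))"

lemma DERIV_cumul: "(cumul has_real_derivative cumul' \<beta>) (at \<beta>)"
proof -
  have "((\<lambda>\<beta>. cgf (v * (1 - \<beta>)) / v + cgf (u * \<beta>) / u) has_real_derivative
      h (v * (1 - \<beta>)) * (v * (0 - 1)) / v + h (u * \<beta>) * (u * 1) / u) (at \<beta>)"
    by (intro DERIV_add DERIV_cdivide DERIV_chain2[OF DERIV_cgf] DERIV_cmult DERIV_diff DERIV_const DERIV_ident)
  then show ?thesis
    using u_pos v_pos by (simp add: cumul_def[abs_def] cumul'_def)
qed

lemma cumul'_strict_mono: "\<beta> < \<beta>' \<Longrightarrow> cumul' \<beta> < cumul' \<beta>'"
  unfolding cumul'_def using h_strict_mono[of "u * \<beta>" "u * \<beta>'"]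
    h_strict_mono[of "v * (1 - \<beta>')" "v * (1 - \<beta>)"] u_pos v_pos by simp

lemma cumul'_0: "cumul' (v / (u + v)) = 0"
proof -
  have "v * (1 - v / (u + v)) = u * (v / (u + v))"
    using u_pos v_pos by (simp add: field_simps)
  then show ?thesis by (simp add: cumul'_def)
qed

lemma cumul'_nonneg: "v / (u + v) \<le> \<beta> \<Longrightarrow> 0 \<le> cumul' \<beta>"
  and cumul'_pos: "v / (u + v) < \<beta> \<Longrightarrow> 0 < cumul' \<beta>"
  and cumul'_neg: "\<beta> < v / (u + v) \<Longrightarrow> cumul' \<beta> < 0"
  using cumul'_strict_mono[of "v / (u + v)" \<beta>] cumul'_strict_mono[of \<beta> "v / (u + v)"] cumul'_0
  by (auto simp: le_less)

lemma critical_bounds: "0 < v / (u + v)" "v / (u + v) < 1"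
  using u_pos v_pos by auto

lemma cumul_tangent: "cumul \<beta> \<ge> cumul x + cumul' x * (\<beta> - x)"
proof -
  have "convex_on UNIV cumul"
    using DERIV_cumul cumul'_strict_mono
    by (intro convex_on_realI[where f' = cumul']) (auto simp: le_less)
  from convex_on_imp_above_tangent[OF this, of x \<beta> "cumul' x"] DERIV_cumul
  show ?thesis by simp
qed

text \<open>The derivative of \<open>cumul\<close> is negative at \<open>0\<close> and positive at \<open>1\<close>, so the two tangents there
  give linear growth in both directions.\<close>

lemma cumul_coercive:
  obtains c K where "c > 0" "\<And>\<beta>. cumul \<beta> \<ge> c * \<bar>\<beta>\<bar> - K"
proof -
  have d0: "cumul' 0 < 0" and d1: "cumul' 1 > 0"
    using critical_bounds by (auto intro: cumul'_neg cumul'_pos)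
  define c where "c = min (cumul' 1) (- cumul' 0)"
  define K where "K = max (cumul' 1 - cumul 1) (- cumul 0)"
  have "c > 0" using d0 d1 by (simp add: c_def)
  moreover have "cumul \<beta> \<ge> c * \<bar>\<beta>\<bar> - K" for \<beta>
  proof (cases "\<beta> \<ge> 0")
    case True
    have "c * \<beta> \<le> cumul' 1 * \<beta>" using True by (intro mult_right_mono) (auto simp: c_def)
    moreover have "cumul' 1 - cumul 1 \<le> K" by (simp add: K_def)
    ultimately show ?thesis using cumul_tangent[of 1 \<beta>] True by (simp add: algebra_simps)
  next
    case False
    have "c * (- \<beta>) \<le> - cumul' 0 * (- \<beta>)"
      using False by (intro mult_right_mono) (auto simp: c_def)
    moreover have "- cumul 0 \<le> K" by (simp add: K_def)
    ultimately show ?thesis using cumul_tangent[of 0 \<beta>] False by (simp add: algebra_simps)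
  qed
  ultimately show thesis by (rule that)
qed

text \<open>Up to constants, \<open>be\<close> and \<open>\<phi>\<close> each use up at most half of
  \<open>e_star\<close>, and \<open>\<delta> * \<psi>\<close> at most
  \<open>(1 + r) * a_star\<close>, by sublinearity. The growth of \<open>cumul\<close>
  remains.\<close>

lemma log_k_coercive:
  obtains c K where "c > 0" "\<And>\<beta>. log_k \<beta> \<ge> c * \<bar>\<beta>\<bar> - K"
proof -
  obtain c K where c: "c > 0" and K: "\<And>\<beta>. cumul \<beta> \<ge> c * \<bar>\<beta>\<bar> - K"
    using cumul_coercive by blast
  obtain K1 where K1: "\<And>x. x \<ge> 0 \<Longrightarrow> be x \<le> K1 + 1/2 * x"
    using concave_halfline_sublinear[OF be_concave _ be_deriv_infinity, of "1/2"] be_C1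
    by (auto simp: C1_halfline_def)
  obtain K2 where K2: "\<And>x. x \<ge> 0 \<Longrightarrow> \<phi> x \<le> K2 + 1/2 * x"
    using concave_halfline_sublinear[OF phi.concave phi.diff phi_deriv_infinity, of "1/2"] by auto
  \<comment> \<open>This slope times \<open>\<bar>\<delta>\<bar>\<close> stays below 1, also for
    \<open>\<delta> = 0\<close>.\<close>
  obtain K3 where K3: "\<And>x. x \<ge> 0 \<Longrightarrow> \<psi> x \<le> K3 + 1 / (\<bar>\<delta>\<bar> + 1) * x"
    by (rule concave_halfline_sublinear[OF psi.concave psi.diff psi_deriv_infinity, of "1 / (\<bar>\<delta>\<bar> + 1)"])
       auto
  have psi: "\<delta> * \<psi> a \<le> \<bar>\<delta>\<bar> * K3 + (1 + r) * a" if "a \<ge> 0" for a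
  proof -
    have "\<delta> * \<psi> a \<le> \<bar>\<delta>\<bar> * \<psi> a" using psi_nonneg[OF that] by (intro mult_right_mono) auto
    also have "\<dots> \<le> \<bar>\<delta>\<bar> * (K3 + 1 / (\<bar>\<delta>\<bar> + 1) * a)" using K3[OF that] by (intro mult_left_mono) auto
    also have "\<dots> = \<bar>\<delta>\<bar> * K3 + (\<bar>\<delta>\<bar> / (\<bar>\<delta>\<bar> + 1)) * a" by (simp add: algebra_simps)
    also have "(\<bar>\<delta>\<bar> / (\<bar>\<delta>\<bar> + 1)) * a \<le> (1 + r) * a"
      using that r_nonneg by (intro mult_right_mono) (auto simp: field_simps)
    finally show ?thesis by simp
  qed
  have "log_k \<beta> \<ge> c * \<bar>\<beta>\<bar> - (K + K1 + K2 + \<bar>\<delta>\<bar> * K3)" for \<beta>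
  proof -
    have "(1 + r) * D \<ge> 0" using r_nonneg D_pos by simp
    then show ?thesis
      unfolding log_k_def
      using K[of \<beta>] K1[OF e_star_nonneg[of \<beta>]] K2[OF e_star_nonneg[of \<beta>]] psi[OF a_star_nonneg[of \<beta>]]
      by simp
  qed
  with c show thesis by (rule that)
qed

lemma ba_upper_bound:
  obtains B where "\<And>x. x \<ge> 0 \<Longrightarrow> ba x \<le> B"
proof -
  obtain B where B: "(SUP x\<in>{0..}. ereal (ba x)) < ereal B"
    using ba_bounded by (auto dest: less_PInf_Ex_of_nat[THEN iffD1])
  show thesis
  proof
    fix x :: real assume "x \<ge> 0"
    then have "ereal (ba x) \<le> (SUP x\<in>{0..}. ereal (ba x))" by (intro SUP_upper) auto
    also note B
    finally show "ba x \<le> B" by simp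
  qed
qed

section \<open>Existence of an equilibrium\<close>

lemma stackelberg_exists: "\<exists>e m a \<alpha> \<beta> \<gamma>. stackelberg e m a \<alpha> \<beta> \<gamma>"
proof -
  \<comment> \<open>The least admissible \<alpha>, optimal for given (\<beta>, \<gamma>) since the
    leader's payoff decreases in \<alpha>.\<close>
  define \<alpha> where "\<alpha> p = max 0 (reserve (fst p) - surplus (snd p))" for p
  define \<Phi> where "\<Phi> p = I1_leader (\<alpha> p) (fst p) (snd p)" for p
  obtain B where B: "\<And>x. x \<ge> 0 \<Longrightarrow> ba x \<le> B" using ba_upper_bound by blast
  obtain c K1 where c: "c > 0" and K1: "\<And>\<beta>. log_k \<beta> \<ge> c * \<bar>\<beta>\<bar> - K1"
    using log_k_coercive by blast
  obtain K2 where K2: "\<And>x. x \<ge> 0 \<Longrightarrow> bm x \<le> K2 + 1/2 * x"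
    using concave_halfline_sublinear[OF bm_concave _ bm_deriv_infinity, of "1/2"] bm_C1
    by (auto simp: C1_halfline_def)
  have \<Phi>_le: "\<Phi> (\<beta>, \<gamma>) \<le> B - exp (u * (gain.resp \<gamma> / 2 + c * \<bar>\<beta>\<bar> - K1 - K2))" if "\<gamma> \<ge> 0" for \<beta> \<gamma>
  proof -
    let ?m = "gain.resp \<gamma>"
    \<comment> \<open>Moving \<alpha> down to the participation bound, even below 0, does not lower
      the payoff, and there the closed form is simplest.\<close>
    have "\<Phi> (\<beta>, \<gamma>) \<le> I1_leader (reserve \<beta> - surplus \<gamma>) \<beta> \<gamma>"
      using I1_leader_less_iff[OF that, of "reserve \<beta> - surplus \<gamma>" \<beta> "\<alpha> (\<beta>, \<gamma>)"]
      by (simp add: \<Phi>_def \<alpha>_def not_less[symmetric])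
    also have "\<dots> = ba (a_star \<beta>) - exp (u * (?m - bm ?m + log_k \<beta>))"
      by (simp add: I1_leader_binding[OF that] k_eq exp_add[symmetric] algebra_simps)
    also have "\<dots> \<le> B - exp (u * (?m / 2 + c * \<bar>\<beta>\<bar> - K1 - K2))"
      using B[OF a_star_nonneg, of \<beta>] K1[of \<beta>] K2[OF gain.resp_nonneg, of \<gamma>] u_pos
      by (intro diff_mono) auto
    finally show ?thesis .
  qed
  \<comment> \<open>Once the growing part reaches \<open>T\<close>, the exponent is at least
    \<open>\<bar>B - \<Phi> (0, 0)\<bar>\<close>, and \<open>exp y \<ge> 1 + y\<close> pushes the
    bound on \<open>\<Phi>\<close> below \<open>\<Phi> (0, 0)\<close>.\<close>
  define T where "T = \<bar>B - \<Phi> (0, 0)\<bar> / u + \<bar>K1\<bar> + \<bar>K2\<bar>"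
  have T: "T \<ge> 0" using u_pos by (simp add: T_def)
  have small: "\<Phi> (\<beta>, \<gamma>) < \<Phi> (0, 0)" if "\<gamma> \<ge> 0" "gain.resp \<gamma> / 2 + c * \<bar>\<beta>\<bar> \<ge> T" for \<beta> \<gamma>
  proof -
    have "u * (\<bar>B - \<Phi> (0, 0)\<bar> / u) \<le> u * (gain.resp \<gamma> / 2 + c * \<bar>\<beta>\<bar> - K1 - K2)"
      using that(2) u_pos by (intro mult_left_mono) (auto simp: T_def)
    then have "\<bar>B - \<Phi> (0, 0)\<bar> \<le> u * (gain.resp \<gamma> / 2 + c * \<bar>\<beta>\<bar> - K1 - K2)"
      using u_pos by simp
    then have "B - \<Phi> (0, 0) < exp (u * (gain.resp \<gamma> / 2 + c * \<bar>\<beta>\<bar> - K1 - K2))"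
      using exp_ge_add_one_self[of "u * (gain.resp \<gamma> / 2 + c * \<bar>\<beta>\<bar> - K1 - K2)"] by linarith
    then show ?thesis using \<Phi>_le[OF that(1), of \<beta>] by simp
  qed
  \<comment> \<open>The payoff bound involves \<gamma> only through
    \<open>gain.resp \<gamma>\<close>; divergence of the latter bounds \<gamma> itself and yields a
    compact rectangle.\<close>
  obtain \<Gamma> where \<Gamma>: "\<Gamma> \<ge> 0" "\<And>\<gamma>. \<gamma> \<ge> \<Gamma> \<Longrightarrow> 2 * T \<le> gain.resp \<gamma>"
  proof -
    have "eventually (\<lambda>\<gamma>. 2 * T \<le> gain.resp \<gamma>) at_top"
      using gain.resp_at_top by (simp add: filterlim_at_top)
    then obtain N where "\<forall>\<gamma>\<ge>N. 2 * T \<le> gain.resp \<gamma>" by (auto simp: eventually_at_top_linorder)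
    then show ?thesis by (intro that[of "max N 0"]) auto
  qed
  define Q where "Q = {- (T / c)..T / c} \<times> {0..\<Gamma>}"
  have "(0, 0) \<in> Q" using T c \<Gamma> by (simp add: Q_def)
  have "continuous_on Q \<Phi>"
  proof -
    have 1: "continuous_on Q (\<lambda>p. f (fst p))" "continuous_on Q (\<lambda>p. f (snd p))"
      if "\<And>A. continuous_on A f" for f :: "real \<Rightarrow> real"
      by (rule continuous_on_compose2[OF that[of UNIV]]; auto intro: continuous_intros)+
    \<comment> \<open>The closed form of the payoff is available for
      \<open>\<gamma> \<ge> 0\<close>, so continuity is shown for the formula and transferred on
      \<open>Q\<close>.\<close>
    have "continuous_on Q (\<lambda>p. ba (a_star (fst p)) - exp (u * (\<alpha> p -
        (reserve (fst p) - surplus (snd p)))) *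
        exp (u * (gain.resp (snd p) - bm (gain.resp (snd p)))) * exp (u * log_k (fst p)))"
      unfolding \<alpha>_def
      by (intro continuous_intros 1 continuous_on_stars continuous_on_reserve continuous_on_surplus
          continuous_on_bm_resp continuous_on_log_k)
    then show ?thesis
      by (rule continuous_on_eq) (auto simp: \<Phi>_def Q_def I1_leader_eq k_eq)
  qed
  then obtain p where p: "p \<in> Q" "\<And>q. q \<in> Q \<Longrightarrow> \<Phi> q \<le> \<Phi> p"
    using continuous_attains_sup[of Q \<Phi>] \<open>(0, 0) \<in> Q\<close> by (auto simp: Q_def compact_Times)
  obtain \<beta> \<gamma> where \<beta>\<gamma>: "p = (\<beta>, \<gamma>)" by force
  have max: "\<Phi> (\<beta>', \<gamma>') \<le> \<Phi> p" if "\<gamma>' \<ge> 0" for \<beta>' \<gamma>'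
  proof (cases "(\<beta>', \<gamma>') \<in> Q")
    case False
    \<comment> \<open>Outside \<open>Q\<close> either \<open>\<gamma>' > \<Gamma>\<close> or
      \<open>\<bar>\<beta>'\<bar> > T / c\<close>, and each alone makes the sum reach
      \<open>T\<close>.\<close>
    have "gain.resp \<gamma>' / 2 + c * \<bar>\<beta>'\<bar> \<ge> T"
    proof (cases "\<gamma>' \<le> \<Gamma>")
      case True
      then have "\<bar>\<beta>'\<bar> \<ge> T / c" using False that by (auto simp: Q_def)
      then show ?thesis using c gain.resp_nonneg[of \<gamma>'] by (simp add: field_simps)
    next
      case False
      then have "gain.resp \<gamma>' \<ge> 2 * T" using \<Gamma> by simp
      moreover have "c * \<bar>\<beta>'\<bar> \<ge> 0" using c by simp
      ultimately show ?thesis by simp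
    qed
    with that have "\<Phi> (\<beta>', \<gamma>') < \<Phi> (0, 0)" by (intro small)
    also have "\<dots> \<le> \<Phi> p" using \<open>(0, 0) \<in> Q\<close> p by simp
    finally show ?thesis by simp
  qed (use p in auto)
  have "stackelberg (e_star \<beta>) (m_star \<gamma>) (a_star \<beta>) (\<alpha> p) \<beta> \<gamma>"
    unfolding stackelberg_def
  proof (intro conjI allI impI refl)
    show "feasible (\<alpha> p) \<beta> \<gamma>"
      using p(1) by (auto simp: feasible_iff \<beta>\<gamma> \<alpha>_def Q_def)
    fix \<alpha>' \<beta>' \<gamma>' assume feas: "feasible \<alpha>' \<beta>' \<gamma>'"
    then have "\<alpha> (\<beta>', \<gamma>') \<le> \<alpha>'" by (auto simp: feasible_iff \<alpha>_def)
    then have "I1_leader \<alpha>' \<beta>' \<gamma>' \<le> \<Phi> (\<beta>', \<gamma>')"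
      using I1_leader_less_iff[of \<gamma>' "\<alpha> (\<beta>', \<gamma>')" \<beta>' \<alpha>'] feas
      by (simp add: \<Phi>_def feasible_iff not_less[symmetric])
    also have "\<dots> \<le> \<Phi> p" using feas by (intro max) (simp add: feasible_iff)
    finally show "I1_leader \<alpha>' \<beta>' \<gamma>' \<le> I1_leader (\<alpha> p) \<beta> \<gamma>" by (simp add: \<Phi>_def \<beta>\<gamma>)
  qed
  then show ?thesis by blast
qed

subsection \<open>First-order conditions\<close>

text \<open>A slack constraint would let the leader lower \<alpha> and gain;
  \<open>\<alpha> > 0\<close> leaves room for this when the participation bound is negative.\<close>

lemma stackelberg_binding:
  assumes st: "stackelberg e m a \<alpha> \<beta> \<gamma>" and "\<alpha> > 0"
  shows "\<alpha> = reserve \<beta> - surplus \<gamma>"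
proof (rule ccontr)
  assume ne: "\<alpha> \<noteq> reserve \<beta> - surplus \<gamma>"
  define \<alpha>' where "\<alpha>' = max 0 (reserve \<beta> - surplus \<gamma>)"
  have feas: "\<gamma> \<ge> 0" "reserve \<beta> - surplus \<gamma> \<le> \<alpha>"
    using st by (auto simp: stackelberg_def feasible_iff)
  then have "\<alpha>' < \<alpha>" and "feasible \<alpha>' \<beta> \<gamma>"
    using ne \<open>\<alpha> > 0\<close> by (auto simp: \<alpha>'_def feasible_iff)
  moreover have "I1_leader \<alpha> \<beta> \<gamma> < I1_leader \<alpha>' \<beta> \<gamma>"
    using feas \<open>\<alpha>' < \<alpha>\<close> by (simp add: I1_leader_less_iff)
  ultimately show False using st by (force simp: stackelberg_def)
qed

text \<open>As long as the constraint \<open>\<alpha> \<ge> 0\<close> is slack, the leader's problem separates into a problem in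
  \<open>\<gamma>\<close> and a problem in \<open>\<beta>\<close>.\<close>

lemma stackelberg_compare:
  assumes st: "stackelberg e m a \<alpha> \<beta> \<gamma>" and "\<alpha> > 0"
    and "\<gamma>' \<ge> 0" "reserve \<beta>' - surplus \<gamma>' > 0"
  shows "ba (a_star \<beta>') - exp (u * (gain.resp \<gamma>' - bm (gain.resp \<gamma>'))) * k \<beta>'
       \<le> ba (a_star \<beta>) - exp (u * (gain.resp \<gamma> - bm (gain.resp \<gamma>))) * k \<beta>"
proof -
  have "feasible (reserve \<beta>' - surplus \<gamma>') \<beta>' \<gamma>'" using assms by (simp add: feasible_iff)
  then have "I1_leader (reserve \<beta>' - surplus \<gamma>') \<beta>' \<gamma>' \<le> I1_leader \<alpha> \<beta> \<gamma>"
    using st by (auto simp: stackelberg_def)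
  moreover have "\<gamma> \<ge> 0" using st by (auto simp: stackelberg_def feasible_iff)
  ultimately show ?thesis
    using assms(3) by (simp add: I1_leader_binding stackelberg_binding[OF st \<open>\<alpha> > 0\<close>])
qed

lemma bm_has_deriv: "x > 0 \<Longrightarrow> (bm has_real_derivative deriv bm x) (at x)"
  and be_has_deriv: "x > 0 \<Longrightarrow> (be has_real_derivative deriv be x) (at x)"
  and ba_has_deriv: "x > 0 \<Longrightarrow> (ba has_real_derivative deriv ba x) (at x)"
  using bm_C1 be_C1 ba_C1 by (auto simp: C1_halfline_def DERIV_deriv_iff_real_differentiable)

text \<open>At the boundary \<open>\<gamma> = 0\<close> a local minimum gives no derivative
  condition, so it is excluded directly: \<open>bm\<close> has slope above 1 near 0, hence
  \<open>x - bm x\<close> decreases there.\<close>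

lemma bm_cost_at_0_not_min:
  assumes "d > 0"
  obtains \<gamma> where "0 < \<gamma>" "\<gamma> < d" "gain.resp \<gamma> - bm (gain.resp \<gamma>) < 0 - bm 0"
proof -
  have "eventually (\<lambda>x. 1 < deriv bm x) (at_right 0)"
    using bm_deriv_0 by (simp add: filterlim_at_top_dense)
  then obtain x0 where x0: "x0 > 0" "\<And>x. 0 < x \<Longrightarrow> x < x0 \<Longrightarrow> 1 < deriv bm x"
    by (auto simp: eventually_at_right_field)
  have "eventually (\<lambda>\<gamma>. gain.resp \<gamma> < x0) (at 0)"
    using order_tendstoD(2)[OF gain.isCont_resp[of 0, unfolded isCont_def]] x0
    by (simp add: gain.resp_nonpos)
  then obtain d' where d': "d' > 0" "\<And>\<gamma>. \<gamma> \<noteq> 0 \<Longrightarrow> \<bar>\<gamma>\<bar> < d' \<Longrightarrow> gain.resp \<gamma> < x0"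
    by (auto simp: eventually_at dist_real_def)
  define \<gamma> where "\<gamma> = min d d' / 2"
  have \<gamma>: "0 < \<gamma>" "\<gamma> < d" "\<gamma> < d'" using assms d' by (auto simp: \<gamma>_def min_def)
  have m: "0 < gain.resp \<gamma>" "gain.resp \<gamma> < x0"
    using \<gamma> d' by (auto intro: gain.resp_pos)
  have "\<exists>y. ((\<lambda>x. x - bm x) has_real_derivative y) (at x) \<and> y < 0"
    if "0 < x" "x < gain.resp \<gamma>" for x
    using x0(2)[of x] that m
    by (intro exI[of _ "1 - deriv bm x"]) (auto intro!: derivative_intros bm_has_deriv)
  moreover have "continuous_on {0..gain.resp \<gamma>} (\<lambda>x. x - bm x)"
    using bm_C1 by (intro continuous_intros) (auto simp: C1_halfline_def elim: continuous_on_subset)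
  ultimately have "gain.resp \<gamma> - bm (gain.resp \<gamma>) < 0 - bm 0"
    by (intro DERIV_neg_imp_decreasing_open[OF m(1)]) auto
  with \<gamma> show thesis by (intro that)
qed

text \<open>For fixed \<beta> the factor \<open>k \<beta>\<close> cancels in the comparison, so
  \<open>m - bm m\<close> is locally minimal. Fermat's condition is applied in the variable
  \<open>m\<close>, through \<open>\<gamma> = 1 / deriv g m\<close>, which asks for no derivative of
  \<open>gain.resp\<close>.\<close>

lemma stackelberg_m:
  assumes st: "stackelberg e m a \<alpha> \<beta> \<gamma>" and "\<alpha> > 0"
  shows "m > 0" "deriv bm m = 1" "\<gamma> = 1 / deriv g m"
proof -
  have feas: "\<gamma> \<ge> 0" and m: "m = gain.resp \<gamma>"
    using st by (auto simp: stackelberg_def feasible_iff m_star_eq)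
  have bind: "\<alpha> = reserve \<beta> - surplus \<gamma>" by (rule stackelberg_binding[OF assms])
  have le: "m - bm m \<le> gain.resp \<gamma>' - bm (gain.resp \<gamma>')"
    if "\<gamma>' \<ge> 0" "reserve \<beta> - surplus \<gamma>' > 0" for \<gamma>'
    using stackelberg_compare[OF assms that] u_pos by (simp add: k_eq m)
  have "isCont (\<lambda>\<gamma>'. reserve \<beta> - surplus \<gamma>') \<gamma>"
    using continuous_on_surplus[of UNIV]
    by (intro continuous_intros) (simp add: continuous_on_eq_continuous_at)
  then have ev: "eventually (\<lambda>\<gamma>'. reserve \<beta> - surplus \<gamma>' > 0) (nhds \<gamma>)"
    by (rule isCont_eventually_greater) (use bind \<open>\<alpha> > 0\<close> in simp)
  have "\<gamma> \<noteq> 0"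
  proof
    assume "\<gamma> = 0"
    from ev obtain d where d: "d > 0" "\<And>\<gamma>'. \<bar>\<gamma>'\<bar> < d \<Longrightarrow> reserve \<beta> - surplus \<gamma>' > 0"
      by (auto simp: eventually_nhds_metric dist_real_def \<open>\<gamma> = 0\<close>)
    obtain \<gamma>' where "0 < \<gamma>'" "\<gamma>' < d" "gain.resp \<gamma>' - bm (gain.resp \<gamma>') < 0 - bm 0"
      using bm_cost_at_0_not_min[OF d(1)] .
    with le[of \<gamma>'] d(2)[of \<gamma>'] show False by (simp add: m \<open>\<gamma> = 0\<close> gain.resp_nonpos)
  qed
  with feas have \<gamma>: "\<gamma> > 0" by simp
  then show pos: "m > 0" by (simp add: m gain.resp_pos)
  show eq: "\<gamma> = 1 / deriv g m" using \<gamma> by (simp add: m gain.deriv_resp)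
  have "isCont (\<lambda>x. 1 / deriv g x) m"
    using gain.deriv_cont pos gain.deriv_pos[OF pos]
    by (intro continuous_intros) (auto simp: continuous_on_eq_continuous_at)
  \<comment> \<open>Every \<open>x\<close> near \<open>m\<close> is the response to a value near
    \<gamma>, where the constraint \<open>\<alpha> \<ge> 0\<close> is still slack.\<close>
  then have "filterlim (\<lambda>x. 1 / deriv g x) (nhds \<gamma>) (nhds m)"
    using tendsto_at_iff_tendsto_nhds[of "\<lambda>x. 1 / deriv g x" m] by (simp add: isCont_def eq)
  from eventually_compose_filterlim[OF ev this]
  have "eventually (\<lambda>x. reserve \<beta> - surplus (1 / deriv g x) > 0 \<and> x > 0) (nhds m)"
    using eventually_nhds_in_open[of "{0<..}" m] pos by (auto intro: eventually_conj)
  then have "eventually (\<lambda>x. m - bm m \<le> x - bm x) (nhds m)"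
  proof eventually_elim
    case (elim x)
    with le[of "1 / deriv g x"] gain.deriv_pos[of x] show ?case by (simp add: gain.resp_deriv)
  qed
  then obtain d where d: "d > 0" "\<And>x. \<bar>m - x\<bar> < d \<Longrightarrow> m - bm m \<le> x - bm x"
    by (auto simp: eventually_nhds_metric dist_real_def abs_minus_commute)
  have "((\<lambda>x. x - bm x) has_real_derivative 1 - deriv bm m) (at m)"
    by (intro derivative_intros bm_has_deriv pos)
  from DERIV_local_min[OF this d(1)] d(2) show "deriv bm m = 1" by simp
qed

text \<open>The tangents at \<open>x\<close> and \<open>y\<close> both have slope 1 and give the two
  inequalities. As \<open>bm\<close> is only concave, the point of slope 1 may not be unique, but
  its cost is.\<close>

lemma bm_cost_unique:
  assumes "x > 0" "deriv bm x = 1" "y > 0" "deriv bm y = 1"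
  shows "x - bm x = y - bm y"
  using concave_halfline_tangent[OF bm_concave, of x y]
    concave_halfline_tangent[OF bm_concave, of y x] assms bm_C1
  by (simp add: C1_halfline_def)

section \<open>Derivative of the reduced payoff in \<beta>\<close>

lemma DERIV_e_part:
  assumes "\<beta> \<noteq> 1"
  shows "((\<lambda>\<beta>. e_star \<beta> - be (e_star \<beta>) - \<phi> (e_star \<beta>)) has_real_derivative
    (if \<beta> < 1 then - S \<beta> else 0)) (at \<beta>)"
proof (cases "\<beta> < 1")
  case True
  define e where "e = e_star \<beta>"
  have e: "e = phi.resp (1 - \<beta>)" by (simp add: e_def e_star_eq)
  have pos: "e > 0" and d1: "deriv \<phi> e = 1 / (1 - \<beta>)"
    using True by (simp_all add: e phi.resp_pos phi.deriv_resp)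
  let ?d = "1 / ((1 - \<beta>)\<^sup>2 * deriv (deriv \<phi>) e)"
  have "((\<lambda>\<beta>. phi.resp (1 - \<beta>)) has_real_derivative
      - 1 / ((1 - \<beta>)\<^sup>2 * deriv (deriv \<phi>) e) * (0 - 1)) (at \<beta>)"
    unfolding e
    by (rule DERIV_chain2[OF phi.DERIV_resp])
       (use True pos e phi_twice_diff phi_deriv2_neg in \<open>auto intro!: derivative_eq_intros\<close>)
  then have de: "(e_star has_real_derivative ?d) (at \<beta>)"
    by (simp add: e_star_eq[abs_def])
  have "((\<lambda>\<beta>. e_star \<beta> - be (e_star \<beta>) - \<phi> (e_star \<beta>)) has_real_derivative
      ?d - deriv be e * ?d - deriv \<phi> e * ?d) (at \<beta>)"
    using be_has_deriv[OF pos] phi.has_deriv[OF pos] unfolding e_def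
    by (intro DERIV_diff de[unfolded e_def] DERIV_chain2[OF _ de[unfolded e_def]])
  \<comment> \<open>Splitting \<open>1 / (1 - \<beta>)\<close>, the slope of \<open>\<phi>\<close>
    at the response, into \<open>1 + \<beta> / (1 - \<beta>)\<close> cancels the unit cost of
    effort.\<close>
  also have "?d - deriv be e * ?d - deriv \<phi> e * ?d = - ((\<beta> / (1 - \<beta>) + deriv be e) * ?d)"
  proof -
    have "1 / (1 - \<beta>) = 1 + \<beta> / (1 - \<beta>)" using True by (simp add: field_simps)
    moreover have "d - b * d - (1 + x) * d = - ((x + b) * d)" for b d x :: real by algebra
    ultimately show ?thesis unfolding d1 by (simp only:)
  qed
  also have "\<dots> = - S \<beta>" by (simp add: S_def e_def)
  finally show ?thesis using True by simp
next
  case False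
  then have "eventually (\<lambda>x. x > 1) (nhds \<beta>)"
    using assms eventually_nhds_in_open[of "{1<..}" \<beta>] by simp
  then have "eventually (\<lambda>x. e_star x - be (e_star x) - \<phi> (e_star x) = 0 - be 0 - \<phi> 0) (nhds \<beta>)"
    by eventually_elim (simp add: e_star_eq phi.resp_nonpos)
  then show ?thesis
    using False by (subst DERIV_cong_ev[OF refl _ refl]) auto
qed

text \<open>\<open>S_tilde\<close> mixes the slope of \<open>ba\<close>, divided by
  \<open>u * K * k \<beta>\<close>, with the cost term. Hence the two derivatives are left abstract
  and only the combination that enters the payoff is fixed.\<close>

lemma DERIV_a_part:
  assumes "\<delta> * (1 - \<beta>) \<noteq> 0"
  defines "K \<equiv> exp (u * (deriv_inv bm 1 - bm (deriv_inv bm 1)))"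
  obtains q b where
    "((\<lambda>\<beta>. (1 + r) * a_star \<beta> - \<delta> * \<psi> (a_star \<beta>)) has_real_derivative q) (at \<beta>)"
    "((\<lambda>\<beta>. ba (a_star \<beta>)) has_real_derivative b) (at \<beta>)"
    "b - u * K * k \<beta> * q = (if \<delta> * (1 - \<beta>) > 0 then u * K * k \<beta> * S_tilde \<beta> else 0)"
proof (cases "\<delta> * (1 - \<beta>) > 0")
  case True
  define a where "a = a_star \<beta>"
  define s where "s = \<delta> * (1 - \<beta>) / (1 + r)"
  have r1: "1 + r > 0" using r_nonneg by simp
  have s: "s > 0" using True r1 by (simp add: s_def)
  have nz: "\<delta> \<noteq> 0" "\<beta> \<noteq> 1" using True by auto
  have a: "a = psi.resp s" by (simp add: a_def a_star_eq s_def)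
  have pos: "a > 0" and d1: "deriv \<psi> a = (1 + r) / (\<delta> * (1 - \<beta>))"
    using s by (simp_all add: a psi.resp_pos psi.deriv_resp) (simp add: s_def)
  let ?d = "(1 + r) / (\<delta> * (1 - \<beta>)\<^sup>2 * deriv (deriv \<psi>) a)"
  have d2: "deriv (deriv \<psi>) a < 0" using pos by (rule psi_deriv2_neg)
  have "((\<lambda>\<beta>. psi.resp (\<delta> * (1 - \<beta>) / (1 + r))) has_real_derivative
      - 1 / (s\<^sup>2 * deriv (deriv \<psi>) a) * (\<delta> * (0 - 1) / (1 + r))) (at \<beta>)"
    unfolding a s_def
    by (rule DERIV_chain2[OF psi.DERIV_resp])
       (use s pos a psi_twice_diff psi_deriv2_neg r1 in \<open>auto intro!: derivative_eq_intros simp: s_def\<close>)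
  also have "- 1 / (s\<^sup>2 * deriv (deriv \<psi>) a) * (\<delta> * (0 - 1) / (1 + r)) = ?d"
  proof -
    have "- 1 / ((\<delta> * w / R)\<^sup>2 * c) * (\<delta> * (0 - 1) / R) = R / (\<delta> * w\<^sup>2 * c)"
      if "w \<noteq> 0" "R \<noteq> 0" "c \<noteq> 0" for w R c :: real
      using nz that by (simp add: power2_eq_square field_simps)
    then show ?thesis using nz r1 d2 by (simp add: s_def)
  qed
  finally have da: "(a_star has_real_derivative ?d) (at \<beta>)"
    by (simp add: a_star_eq[abs_def])
  let ?q = "(1 + r) * ?d - \<delta> * (deriv \<psi> a * ?d)"
  show thesis
  proof
    show "((\<lambda>\<beta>. (1 + r) * a_star \<beta> - \<delta> * \<psi> (a_star \<beta>)) has_real_derivative ?q) (at \<beta>)"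
      using psi.has_deriv[OF pos] unfolding a_def
      by (intro DERIV_diff DERIV_cmult da[unfolded a_def] DERIV_chain2[OF _ da[unfolded a_def]])
    show "((\<lambda>\<beta>. ba (a_star \<beta>)) has_real_derivative deriv ba a * ?d) (at \<beta>)"
      using ba_has_deriv[OF pos] unfolding a_def by (rule DERIV_chain2[OF _ da[unfolded a_def]])
    have K: "u * K * k \<beta> > 0" using u_pos by (simp add: K_def k_eq)
    have "?q = (1 + r - \<delta> * deriv \<psi> a) * ?d"
      by (simp only: left_diff_distrib mult.assoc)
    \<comment> \<open>The first-order condition \<open>d1\<close> makes the marginal net cost of
      \<open>a\<close> proportional to \<open>\<beta> / (1 - \<beta>)\<close>.\<close>
    also have "1 + r - \<delta> * deriv \<psi> a = - ((1 + r) * (\<beta> / (1 - \<beta>)))"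
      unfolding d1 using nz by (simp add: field_simps)
    finally have q: "?q = - ((1 + r) * (\<beta> / (1 - \<beta>))) * ?d" .
    have "S_tilde \<beta> = ?d * ((1 + r) * (\<beta> / (1 - \<beta>)) + deriv ba a / (u * K * k \<beta>))"
      by (simp add: S_tilde_def a_def K_def)
    moreover have "w * (d * (x + b / w)) = b * d - w * (- x * d)" if "w \<noteq> 0" for w d x b :: real
      using that by (simp add: field_simps)
    ultimately have "u * K * k \<beta> * S_tilde \<beta> = deriv ba a * ?d - u * K * k \<beta> * ?q"
      unfolding q using K by (metis less_irrefl)
    then show "deriv ba a * ?d - u * K * k \<beta> * ?q =
        (if \<delta> * (1 - \<beta>) > 0 then u * K * k \<beta> * S_tilde \<beta> else 0)"
      using True by simp
  qed
next
  case False
  then have neg: "0 < - (\<delta> * (1 - \<beta>))" using assms by linarith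
  \<comment> \<open>The strict inequality persists near \<beta>, where \<open>a_star\<close> is then
    constantly 0.\<close>
  have "eventually (\<lambda>x. 0 < - (\<delta> * (1 - x))) (nhds \<beta>)"
    by (rule isCont_eventually_greater[where f = "\<lambda>x. - (\<delta> * (1 - x))", OF _ neg]) (intro continuous_intros)
  then have ev: "eventually (\<lambda>x. a_star x = 0) (nhds \<beta>)"
    by eventually_elim (use r_nonneg in \<open>auto simp: a_star_eq intro!: psi.resp_nonpos divide_nonpos_pos\<close>)
  show thesis
  proof
    show "((\<lambda>\<beta>. (1 + r) * a_star \<beta> - \<delta> * \<psi> (a_star \<beta>)) has_real_derivative 0) (at \<beta>)"
      by (subst DERIV_cong_ev[OF refl _ refl, where g = "\<lambda>_. (1 + r) * 0 - \<delta> * \<psi> 0"])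
         (use ev in \<open>auto elim: eventually_mono\<close>)
    show "((\<lambda>\<beta>. ba (a_star \<beta>)) has_real_derivative 0) (at \<beta>)"
      by (subst DERIV_cong_ev[OF refl _ refl, where g = "\<lambda>_. ba 0"])
         (use ev in \<open>auto elim: eventually_mono\<close>)
  qed (use False in simp)
qed

text \<open>The factor \<open>u * K * k \<beta>\<close> is positive, so critical points are the
  zeros of the bracket. Its conditionals record which responses are nonzero: \<open>e_star\<close>
  for \<open>\<beta> < 1\<close>, \<open>a_star\<close> for
  \<open>\<delta> * (1 - \<beta>) > 0\<close>.\<close>

lemma DERIV_reduced_payoff:
  assumes "\<delta> \<noteq> 0" "\<beta> \<noteq> 1"
  defines "K \<equiv> exp (u * (deriv_inv bm 1 - bm (deriv_inv bm 1)))"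
  shows "((\<lambda>\<beta>. ba (a_star \<beta>) - K * k \<beta>) has_real_derivative
    - (u * K * k \<beta>) * (cumul' \<beta> - (if \<beta> < 1 then S \<beta> else 0) -
       (if \<delta> * (1 - \<beta>) > 0 then S_tilde \<beta> else 0))) (at \<beta>)"
proof -
  from assms have "\<delta> * (1 - \<beta>) \<noteq> 0" by simp
  from DERIV_a_part[OF this] obtain q b where q:
    "((\<lambda>\<beta>. (1 + r) * a_star \<beta> - \<delta> * \<psi> (a_star \<beta>)) has_real_derivative q) (at \<beta>)" and b:
    "((\<lambda>\<beta>. ba (a_star \<beta>)) has_real_derivative b) (at \<beta>)" and qb:
    "b - u * K * k \<beta> * q = (if \<delta> * (1 - \<beta>) > 0 then u * K * k \<beta> * S_tilde \<beta> else 0)"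
    unfolding K_def by blast
  let ?p = "if \<beta> < 1 then - S \<beta> else 0"
  have "(log_k has_real_derivative ?p + q + 0 + cumul' \<beta>) (at \<beta>)"
    unfolding log_k_def[abs_def]
    by (intro DERIV_add DERIV_e_part[OF assms(2)] q DERIV_const DERIV_cumul)
  then have "((\<lambda>\<beta>. exp (u * log_k \<beta>)) has_real_derivative
      exp (u * log_k \<beta>) * (u * (?p + q + 0 + cumul' \<beta>))) (at \<beta>)"
    by (intro DERIV_chain2[OF DERIV_exp] DERIV_cmult)
  then have "((\<lambda>\<beta>. ba (a_star \<beta>) - K * k \<beta>) has_real_derivative
      b - K * (k \<beta> * (u * (?p + q + 0 + cumul' \<beta>)))) (at \<beta>)"
    unfolding k_eq[abs_def] by (intro DERIV_diff b DERIV_cmult)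
  also have "b - K * (k \<beta> * (u * (?p + q + 0 + cumul' \<beta>))) =
      (b - u * K * k \<beta> * q) - u * K * k \<beta> * (?p + cumul' \<beta>)"
    by (simp add: algebra_simps)
  also have "\<dots> = - (u * K * k \<beta>) * (cumul' \<beta> - (if \<beta> < 1 then S \<beta> else 0) -
       (if \<delta> * (1 - \<beta>) > 0 then S_tilde \<beta> else 0))"
    unfolding qb by (simp add: algebra_simps)
  finally show ?thesis .
qed

section \<open>Sign of the marginal payoff and location of \<beta>\<close>

lemma S_neg:
  assumes "0 < \<beta>" "\<beta> < 1" shows "S \<beta> < 0"
proof -
  have pos: "e_star \<beta> > 0" using assms by (simp add: e_star_eq phi.resp_pos)
  have "deriv be (e_star \<beta>) \<ge> 0"
    using be_mono pos be_C1 by (intro mono_on_halfline_deriv_nonneg) (auto simp: C1_halfline_def)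
  then have "\<beta> / (1 - \<beta>) + deriv be (e_star \<beta>) > 0" using assms by (simp add: add_pos_nonneg)
  moreover have "(1 - \<beta>)\<^sup>2 * deriv (deriv \<phi>) (e_star \<beta>) < 0"
    using assms phi_deriv2_neg[OF pos] by (simp add: mult_pos_neg)
  ultimately show ?thesis unfolding S_def by (rule divide_pos_neg)
qed

lemma S_tilde_nonpos:
  assumes "\<delta> > 0" "0 < \<beta>" "\<beta> < 1" shows "S_tilde \<beta> \<le> 0"
proof -
  have pos: "a_star \<beta> > 0" using assms r_nonneg by (simp add: a_star_eq psi.resp_pos)
  have "deriv ba (a_star \<beta>) \<ge> 0"
    using ba_mono pos ba_C1 by (intro mono_on_halfline_deriv_nonneg) (auto simp: C1_halfline_def)
  then have "(1 + r) * (\<beta> / (1 - \<beta>)) + deriv ba (a_star \<beta>) /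
      (u * exp (u * (deriv_inv bm 1 - bm (deriv_inv bm 1))) * k \<beta>) \<ge> 0"
    using assms u_pos r_nonneg by (simp add: k_eq)
  moreover have "\<delta> * (1 - \<beta>)\<^sup>2 * deriv (deriv \<psi>) (a_star \<beta>) < 0"
    using assms psi_deriv2_neg[OF pos] by (simp add: mult_pos_neg)
  then have "(1 + r) / (\<delta> * (1 - \<beta>)\<^sup>2 * deriv (deriv \<psi>) (a_star \<beta>)) \<le> 0"
    using r_nonneg by (simp add: divide_nonneg_neg)
  ultimately show ?thesis unfolding S_tilde_def by (intro mult_nonpos_nonneg)
qed

text \<open>Strictness at the left endpoint, where \<open>cumul'\<close> vanishes, comes from
  \<open>S \<beta> < 0\<close>.\<close>

lemma marginal_pos:
  assumes "v / (u + v) \<le> \<beta>" "\<beta> < 1"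
  shows "cumul' \<beta> - S \<beta> - (if \<delta> * (1 - \<beta>) > 0 then S_tilde \<beta> else 0) > 0"
proof -
  have \<beta>: "0 < \<beta>" using critical_bounds assms by simp
  have "\<delta> > 0" if "\<delta> * (1 - \<beta>) > 0" using that assms by (simp add: zero_less_mult_iff)
  then show ?thesis
    using cumul'_nonneg[OF assms(1)] S_neg[OF \<beta> assms(2)] S_tilde_nonpos[OF _ \<beta> assms(2)] by auto
qed

text \<open>Fixing \<gamma> makes \<beta> a local maximum of \<open>F\<close>. The derivative of
  \<open>F\<close> is known only off 1, so the point 1 is excluded first, by strict decrease of
  \<open>F\<close> on its left.\<close>

lemma stackelberg_beta:
  assumes st: "stackelberg e m a \<alpha> \<beta> \<gamma>" and \<alpha>: "\<alpha> > 0" and "\<delta> \<noteq> 0"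
  shows "\<beta> \<noteq> 1" "cumul' \<beta> = (if \<beta> < 1 then S \<beta> else 0) + (if \<delta> * (1 - \<beta>) > 0 then S_tilde \<beta> else 0)"
proof -
  define K where "K = exp (u * (deriv_inv bm 1 - bm (deriv_inv bm 1)))"
  define F where "F = (\<lambda>\<beta>. ba (a_star \<beta>) - K * k \<beta>)"
  let ?L = "\<lambda>\<beta>. cumul' \<beta> - (if \<beta> < 1 then S \<beta> else 0) -
       (if \<delta> * (1 - \<beta>) > 0 then S_tilde \<beta> else 0)"
  have Kpos: "u * K * k x > 0" for x using u_pos by (simp add: K_def k_eq)
  have dF: "(F has_real_derivative - (u * K * k x) * ?L x) (at x)" if "x \<noteq> 1" for x
    unfolding F_def K_def by (rule DERIV_reduced_payoff[OF \<open>\<delta> \<noteq> 0\<close> that])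
  have contF: "continuous_on A F" for A
    unfolding F_def k_eq by (intro continuous_intros continuous_on_stars continuous_on_log_k)
  have feas: "\<gamma> \<ge> 0" and m: "m = gain.resp \<gamma>"
    using st by (auto simp: stackelberg_def feasible_iff m_star_eq)
  \<comment> \<open>The choice made by \<open>deriv_inv\<close> may differ from \<open>m\<close>,
    but both have slope 1 and thus the same cost.\<close>
  have "m \<in> deriv_level bm 1" using stackelberg_m[OF st \<alpha>] by (simp add: deriv_level_def one_ereal_def)
  then have "deriv_inv bm 1 \<in> deriv_level bm 1" unfolding deriv_inv_def by (rule someI)
  then have "deriv_inv bm 1 > 0" "deriv bm (deriv_inv bm 1) = 1"
    by (auto simp: deriv_level_def one_ereal_def)
  then have "deriv_inv bm 1 - bm (deriv_inv bm 1) = m - bm m"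
    using stackelberg_m(1,2)[OF st \<alpha>] by (intro bm_cost_unique)
  then have K: "K = exp (u * (gain.resp \<gamma> - bm (gain.resp \<gamma>)))"
    by (simp add: K_def m)
  have "isCont (\<lambda>x. reserve x - surplus \<gamma>) \<beta>"
    using continuous_on_reserve[of UNIV]
    by (intro continuous_intros) (simp add: continuous_on_eq_continuous_at)
  then have "eventually (\<lambda>x. reserve x - surplus \<gamma> > 0) (nhds \<beta>)"
    by (rule isCont_eventually_greater) (use stackelberg_binding[OF st \<alpha>] \<alpha> in simp)
  then obtain d where d: "d > 0" "\<And>x. \<bar>\<beta> - x\<bar> < d \<Longrightarrow> reserve x - surplus \<gamma> > 0"
    by (auto simp: eventually_nhds_metric dist_real_def abs_minus_commute)
  have max: "F x \<le> F \<beta>" if "\<bar>\<beta> - x\<bar> < d" for x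
    using stackelberg_compare[OF st \<alpha> feas d(2)[OF that]] by (simp add: F_def K)
  show "\<beta> \<noteq> 1"
  proof
    assume "\<beta> = 1"
    \<comment> \<open>Close enough to 1 for the local comparison, and inside the interval where
      \<open>marginal_pos\<close> applies.\<close>
    define x where "x = max (v / (u + v)) (1 - d / 2)"
    have x: "x < 1" "v / (u + v) \<le> x" "\<bar>1 - x\<bar> < d"
      using d critical_bounds by (auto simp: x_def max_def)
    have "F 1 < F x"
    proof (rule DERIV_neg_imp_decreasing_open[OF x(1) _ contF])
      fix y assume y: "x < y" "y < 1"
      have "?L y > 0" using marginal_pos[of y] x y by simp
      then have "- (u * K * k y) * ?L y < 0" using Kpos[of y] by (simp only: mult_neg_pos neg_less_0_iff_less)
      then show "\<exists>z. (F has_real_derivative z) (at y) \<and> z < 0"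
        using dF[of y] y by blast
    qed
    with max[of x] x \<open>\<beta> = 1\<close> show False by simp
  qed
  from DERIV_local_max[OF dF[OF this] d(1)] max have "- (u * K * k \<beta>) * ?L \<beta> = 0" by blast
  then have "?L \<beta> = 0" using Kpos[of \<beta>]
    by (metis less_irrefl mult_eq_0_iff neg_equal_0_iff_equal)
  then show "cumul' \<beta> = (if \<beta> < 1 then S \<beta> else 0) + (if \<delta> * (1 - \<beta>) > 0 then S_tilde \<beta> else 0)"
    by simp
qed

text \<open>For \<open>\<delta> > 0\<close> and \<open>\<beta> > 1\<close> both responses vanish and
  \<open>cumul' \<beta> = 0\<close> would follow, which fails beyond \<open>v / (u + v)\<close>. For
  \<open>\<delta> < 0\<close> exactly one response is active on each side of 1.\<close>

lemma stackelberg_beta_cases: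
  assumes "stackelberg e m a \<alpha> \<beta> \<gamma>" "\<alpha> > 0"
  shows "\<delta> > 0 \<Longrightarrow> \<beta> < v / (u + v) \<and> cumul' \<beta> = S \<beta> + S_tilde \<beta>"
    and "\<delta> < 0 \<Longrightarrow> \<beta> < v / (u + v) \<and> cumul' \<beta> = S \<beta> \<or> \<beta> > 1 \<and> cumul' \<beta> = S_tilde \<beta>"
proof -
  have lt: "\<beta> < v / (u + v)" if "\<delta> \<noteq> 0" "\<beta> < 1"
    using marginal_pos[of \<beta>] stackelberg_beta[OF assms] that by force
  show "\<beta> < v / (u + v) \<and> cumul' \<beta> = S \<beta> + S_tilde \<beta>" if "\<delta> > 0"
  proof -
    have "\<beta> < 1"
    proof (rule ccontr)
      assume "\<not> \<beta> < 1"
      moreover from this have "\<not> \<delta> * (1 - \<beta>) > 0" using that by (simp add: zero_less_mult_iff)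
      ultimately show False
        using stackelberg_beta[OF assms] cumul'_pos[of \<beta>] critical_bounds that by simp
    qed
    then show ?thesis using lt stackelberg_beta(2)[OF assms] that by simp
  qed
  show "\<beta> < v / (u + v) \<and> cumul' \<beta> = S \<beta> \<or> \<beta> > 1 \<and> cumul' \<beta> = S_tilde \<beta>" if "\<delta> < 0"
    using lt stackelberg_beta[OF assms] that by (cases "\<beta> < 1") (auto simp: zero_less_mult_iff)
qed

section \<open>The optimal \<alpha> and the values of both firms\<close>

lemma stackelberg_alpha:
  assumes st: "stackelberg e m a \<alpha> \<beta> \<gamma>" and \<alpha>: "\<alpha> > 0"
  shows "\<alpha> = C \<beta> + (1 + r) * (D + a) + e - (1 - \<beta>) * \<delta> * \<psi> a - G m"
proof -
  have "\<gamma> \<ge> 0" and e: "e = e_star \<beta>" and a: "a = a_star \<beta>" and m: "m = gain.resp \<gamma>"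
    using st by (auto simp: stackelberg_def feasible_iff m_star_eq)
  have "surplus \<gamma> = \<gamma> * g m - m" by (simp only: surplus_def m)
  also have "\<dots> = G m" using stackelberg_m(3)[OF st \<alpha>] by (simp add: G_def)
  finally have "surplus \<gamma> = G m" .
  then show ?thesis
    using stackelberg_binding[OF st \<alpha>] by (simp add: reserve_def e a)
qed

lemma stackelberg_values:
  assumes st: "stackelberg e m a \<alpha> \<beta> \<gamma>" and \<alpha>: "\<alpha> > 0"
  shows "J1 \<alpha> \<beta> \<gamma> a e m = V 0" "value_J \<alpha> \<beta> \<gamma> = V 0" "value_I = I1 \<alpha> \<beta> \<gamma> a e m"
proof -
  have feas: "feasible \<alpha> \<beta> \<gamma>" "\<gamma> \<ge> 0"
    and eam: "e = e_star \<beta>" "a = a_star \<beta>" "m = m_star \<gamma>"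
    and opt: "\<And>\<alpha>' \<beta>' \<gamma>'. feasible \<alpha>' \<beta>' \<gamma>' \<Longrightarrow> I1_leader \<alpha>' \<beta>' \<gamma>' \<le> I1_leader \<alpha> \<beta> \<gamma>"
    using st by (auto simp: stackelberg_def feasible_iff)
  show J: "J1 \<alpha> \<beta> \<gamma> a e m = V 0"
    using J1_best_response[OF feas(2)] stackelberg_binding[OF st \<alpha>] by (simp add: V_def eam)
  \<comment> \<open>Positivity of \<gamma> gives access to \<open>best_response_optimal\<close>, so
    the supremum over the controls of firm J is attained at the equilibrium.\<close>
  have "\<gamma> > 0" using stackelberg_m[OF st \<alpha>] gain.deriv_pos[of m] by simp
  then have "J1 \<alpha> \<beta> \<gamma> a' e' m' \<le> V 0" if "a' \<ge> 0" "e' \<ge> 0" "m' \<ge> 0" for a' e' m'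
    using best_response_optimal[of \<gamma> a' e' m' \<alpha> \<beta>] that J by (simp add: eam)
  moreover have "m \<ge> 0" using stackelberg_m[OF st \<alpha>] by simp
  ultimately show "value_J \<alpha> \<beta> \<gamma> = V 0"
    unfolding value_J_def using J[symmetric] a_star_nonneg[of \<beta>] e_star_nonneg[of \<beta>]
    by (intro cSup_eq_maximum) (auto simp: eam)
  show "value_I = I1 \<alpha> \<beta> \<gamma> a e m"
    unfolding value_I_def using feas(1) opt
    by (intro cSup_eq_maximum) (auto simp: eam I1_leader_def)
qed

end

theorem theorem5:
  fixes M :: "'w measure" and \<mu> :: "'w \<Rightarrow> real" and \<mu>\<^sub>0 u v D r \<delta> :: real
    and \<phi> \<psi> g ba bm be :: "real \<Rightarrow> real"
  assumes "situation1 M \<mu> \<mu>\<^sub>0 u v D r \<delta> \<phi> \<psi> g ba bm be"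
  shows "(\<exists>e m a \<alpha> \<beta> \<gamma>. situation1.stackelberg M \<mu> u v D r \<delta> \<phi> \<psi> g ba bm be e m a \<alpha> \<beta> \<gamma>) \<and>
    (\<forall>e m a \<alpha> \<beta> \<gamma>.
       situation1.stackelberg M \<mu> u v D r \<delta> \<phi> \<psi> g ba bm be e m a \<alpha> \<beta> \<gamma> \<and> \<alpha> > 0 \<longrightarrow>
       e = deriv_inv \<phi> (1 / ereal (max (1 - \<beta>) 0)) \<and>
       a = deriv_inv \<psi> (ereal (1 + r) / ereal (max (\<delta> * (1 - \<beta>)) 0)) \<and>
       m \<in> deriv_level bm 1 \<and>
       \<gamma> = 1 / deriv g m \<and>
       \<alpha> = situation1.C M \<mu> v \<phi> \<beta> + (1 + r) * (D + a) + e
             - (1 - \<beta>) * \<delta> * \<psi> a - situation1.G g m \<and>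
       (\<delta> > 0 \<longrightarrow>
          \<beta> < v / (u + v) \<and>
          situation1.h M \<mu> (u * \<beta>) - situation1.h M \<mu> (v * (1 - \<beta>)) =
            situation1.S \<phi> be \<beta> + situation1.S_tilde M \<mu> u v D r \<delta> \<phi> \<psi> ba bm be \<beta>) \<and>
       (\<delta> < 0 \<longrightarrow>
          (\<beta> < v / (u + v) \<and>
           situation1.h M \<mu> (u * \<beta>) - situation1.h M \<mu> (v * (1 - \<beta>)) =
             situation1.S \<phi> be \<beta>) \<or>
          (\<beta> > 1 \<and>
           situation1.h M \<mu> (u * \<beta>) - situation1.h M \<mu> (v * (1 - \<beta>)) =
             situation1.S_tilde M \<mu> u v D r \<delta> \<phi> \<psi> ba bm be \<beta>)) \<and>
       situation1.J1 M \<mu> v D r \<delta> \<phi> \<psi> g \<alpha> \<beta> \<gamma> a e m = situation1.V v 0 \<and>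
       situation1.value_J M \<mu> v D r \<delta> \<phi> \<psi> g \<alpha> \<beta> \<gamma> = situation1.V v 0 \<and>
       situation1.value_I M \<mu> u v D r \<delta> \<phi> \<psi> g ba bm be =
         situation1.I1 M \<mu> u \<delta> \<phi> \<psi> g ba bm be \<alpha> \<beta> \<gamma> a e m)"
proof -
  interpret situation1 M \<mu> \<mu>\<^sub>0 u v D r \<delta> \<phi> \<psi> g ba bm be by fact
  show ?thesis
  proof (intro conjI allI impI; (elim conjE)?)
    show "\<exists>e m a \<alpha> \<beta> \<gamma>. stackelberg e m a \<alpha> \<beta> \<gamma>" by (rule stackelberg_exists)
    fix e m a \<alpha> \<beta> \<gamma>
    assume st: "stackelberg e m a \<alpha> \<beta> \<gamma>" "\<alpha> > 0"
    show "e = deriv_inv \<phi> (1 / ereal (max (1 - \<beta>) 0))"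
      "a = deriv_inv \<psi> (ereal (1 + r) / ereal (max (\<delta> * (1 - \<beta>)) 0))"
      using st by (auto simp: stackelberg_def e_star_def a_star_def)
    show "m \<in> deriv_level bm 1" "\<gamma> = 1 / deriv g m"
      using stackelberg_m[OF st] by (simp_all add: deriv_level_def one_ereal_def)
    show "\<alpha> = C \<beta> + (1 + r) * (D + a) + e - (1 - \<beta>) * \<delta> * \<psi> a - G m"
      by (rule stackelberg_alpha[OF st])
    show "\<beta> < v / (u + v)" "h (u * \<beta>) - h (v * (1 - \<beta>)) = S \<beta> + S_tilde \<beta>" if "\<delta> > 0"
      using stackelberg_beta_cases(1)[OF st that] by (simp_all add: cumul'_def)
    show "\<beta> < v / (u + v) \<and> h (u * \<beta>) - h (v * (1 - \<beta>)) = S \<beta> \<or>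
        \<beta> > 1 \<and> h (u * \<beta>) - h (v * (1 - \<beta>)) = S_tilde \<beta>" if "\<delta> < 0"
      using stackelberg_beta_cases(2)[OF st that] by (simp add: cumul'_def)
    show "J1 \<alpha> \<beta> \<gamma> a e m = V 0" "value_J \<alpha> \<beta> \<gamma> = V 0" "value_I = I1 \<alpha> \<beta> \<gamma> a e m"
      by (rule stackelberg_values[OF st])+
  qed
qed

end
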